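(* Fix $\varepsilon>0$, and let $d=d(n)\in\{0,1,\dots,n\}$ be any integer-valued function of $n$ satisfying $\min(d,n-d)\geq (1+\varepsilon)\log n$ for all sufficiently large $n$. Let $Q$ be a random $n\times n$ zero-one matrix with independent rows, where each row is chosen uniformly at random among the vectors in $\{0,1\}^n$ having exactly $d$ ones. Then \[\lim_{n\to\infty}\Pr(Q\text{ is singular})=0.\]
   Context: Logarithms are to base $e$. Singularity of the zero-one matrix $Q$ is meant over $\mathbb{R}$ (equivalently over $\mathbb{Q}$). *)

theory Defs
  imports "HOL-Probability.Probability" "Jordan_Normal_Form.Matrix"
begin

definition zero_one_vecs :: "nat \<Rightarrow> nat \<Rightarrow> real vec set" where
  "zero_one_vecs n d =
     {v \<in> carrier_vec n. (\<forall>j<n. v $ j \<in> {0, 1}) \<and> card {j. j < n \<and> v $ j = 1} = d}"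

(* The following two facts are the side conditions under which pmf_of_set
   really is the uniform distribution on its argument. *)

lemma finite_zero_one_vecs: "finite (zero_one_vecs n d)"
proof -
  have "zero_one_vecs n d \<subseteq> (\<lambda>S. vec n (\<lambda>j. if j \<in> S then 1 else 0)) ` Pow {..<n}"
  proof
    fix v assume v: "v \<in> zero_one_vecs n d"
    have "v = vec n (\<lambda>j. if j \<in> {j. j < n \<and> v $ j = 1} then 1 else 0)"
      using v by (intro eq_vecI) (auto simp: zero_one_vecs_def)
    moreover have "{j. j < n \<and> v $ j = 1} \<in> Pow {..<n}" by auto
    ultimately show "v \<in> (\<lambda>S. vec n (\<lambda>j. if j \<in> S then 1 else 0)) ` Pow {..<n}"
      by (rule image_eqI)
  qed
  then show ?thesis by (rule finite_subset) simp
qed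

lemma zero_one_vecs_nonempty:
  assumes "d \<le> n"
  shows "zero_one_vecs n d \<noteq> {}"
proof -
  let ?v = "vec n (\<lambda>j. if j < d then 1 else 0) :: real vec"
  have "{j. j < n \<and> ?v $ j = 1} = {..<d}" using assms by (auto split: if_splits)
  then have "?v \<in> zero_one_vecs n d" by (simp add: zero_one_vecs_def)
  then show ?thesis by blast
qed

(* Independence of the rows is the product measure Pi_pmf; its second argument
   (the value outside the index set) does not influence the matrix. *)
definition random_zero_one_mat :: "nat \<Rightarrow> nat \<Rightarrow> real mat pmf" where
  "random_zero_one_mat n d =
     map_pmf (\<lambda>r. mat n n (\<lambda>(i, j). r i $ j))
       (Pi_pmf {..<n} (0\<^sub>v n) (\<lambda>_. pmf_of_set (zero_one_vecs n d)))"

end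

(* Let t = c n for a small constant c, and suppose that the matrix is singular. Either some nonempty
   set of fewer than t rows has sum 0 modulo 2 (take the odd coordinates of an integral left kernel
   vector that is not divisible by 2), or at least t rows lie in the span of the other rows. By
   Markov's inequality it suffices to bound the probability that a given row i lies in this span.
   Fix a nonzero integral vector y orthogonal to all other rows; row i is then orthogonal to y. If
   some value v is taken by all but fewer than t coordinates of y, then y - v yields, modulo 2, a
   nonempty set T with card T < t whose intersections with the other rows all have the same parity.
   Otherwise y has many disjoint pairs of distinct coordinates, and an Erdos-Littlewood-Offord
   argument shows that a random row is orthogonal to y with probability o(1). The two events about
   sparse sets modulo 2 are excluded by union bounds. *)
theory Submission
  imports Defs "Jordan_Normal_Form.Determinant" "HOL-Real_Asymp.Real_Asymp"
begin

text \<open>Both union bounds run on the scale \<open>L = d * (n - d) / n\<close>. A singleton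
  \<open>T\<close> is a column that is constant on the other rows; its probability is estimated by
  exp (-L) up to lower order, so n * exp (-L) has to vanish. This is where the factor 1 + \<epsilon>
  is spent: small sets need the constant 1 in the exponent, while factors polynomial in L are
  harmless. The obstacle is that the entries of a row are dependent. For a column set the rows are
  still independent, and the parity bias of one row is raised to the power n - 1. For a row set all
  n coordinates of a sum must vanish at once, and no such product is at hand; the rows are therefore
  viewed as conditioned Bernoulli rows, at the price of a factor 12 L each. For large sets this
  price is limited by estimating with only some of the rows. Both events obey the same bound
  \<open>decay\<close>, so one union bound serves for both. The threshold t must be linear in n:
  Markov's inequality then loses only the constant 1 / c, and o(1) per row is enough. A small c
  keeps the number of sparse sets below the exponential saving for large sets.\<close>

section \<open>Concentration of subset sums\<close>

text \<open>\<open>walk_count m j\<close> counts the \<open>m\<close>-step walks with steps \<open>1\<close> and \<open>-1\<close> that start at \<open>j\<close> and stay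
  positive; \<open>walk_count m 1\<close> is the central binomial coefficient of Erdos' bound.\<close>

fun walk_count :: "nat \<Rightarrow> nat \<Rightarrow> nat" where
  "walk_count m 0 = 0"
| "walk_count 0 (Suc j) = 1"
| "walk_count (Suc m) (Suc j) = walk_count m (Suc (Suc j)) + walk_count m j"

lemma walk_count_le_power: "walk_count m j \<le> 2 ^ m"
proof (induction m j rule: walk_count.induct)
  case (3 m j)
  then show ?case by simp
qed auto

text \<open>Gambler's ruin: a walk that stays positive either reaches \<open>J\<close> or remains inside \<open>(0, J)\<close>, where it
  survives an expected time of \<open>j * (J - j)\<close>.\<close>

lemma walk_count_bound:
  assumes "0 < J" "j \<le> J"
  shows "real m * (real (walk_count m j) / 2 ^ m) \<le> real m * real j / real J + real j * (real J - real j)"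
  using assms(2)
proof (induction m arbitrary: j)
  case 0
  then show ?case by simp
next
  case (Suc m)
  show ?case
  proof (cases j)
    case 0
    then show ?thesis by simp
  next
    case j: (Suc i)
    show ?thesis
    proof (cases "j = J")
      case True
      have "real (walk_count (Suc m) j) / 2 ^ Suc m \<le> 1"
        using walk_count_le_power[of "Suc m" j] by (simp del: walk_count.simps power_Suc add: divide_simps)
      then have "real (Suc m) * (real (walk_count (Suc m) j) / 2 ^ Suc m) \<le> real (Suc m) * 1"
        by (intro mult_left_mono) auto
      then show ?thesis using True assms by simp
    next
      case False
      define a where "a = real (walk_count m (Suc j)) / 2 ^ m"
      define b where "b = real (walk_count m i) / 2 ^ m"
      have w: "real (walk_count (Suc m) j) / 2 ^ Suc m = (a + b) / 2"
        by (simp add: j a_def b_def field_simps)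
      have "a \<le> 1" "b \<le> 1"
        using walk_count_le_power[of m "Suc j"] walk_count_le_power[of m i]
        by (simp_all add: a_def b_def divide_simps)
      define c where "c = real m / real J"
      have c: "real m * y / real J = c * y" for y by (simp add: c_def)
      have "real m * a \<le> c * real (Suc j) + real (Suc j) * (real J - real (Suc j))"
        using Suc.IH[of "Suc j"] False Suc.prems unfolding a_def c by simp
      moreover have "real m * b \<le> c * real i + real i * (real J - real i)"
        using Suc.IH[of i] j Suc.prems unfolding b_def c by simp
      \<comment> \<open>The function \<open>j * (J - j)\<close> has second difference -2, as for the
        expected duration in gambler's ruin. The spare 2 pays for \<open>a + b\<close>, that is, for
        passing from \<open>m\<close> to \<open>Suc m\<close>.\<close>
      ultimately have "real m * (a + b) \<le> 2 * (c * real j + real j * (real J - real j)) - 2"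
        unfolding j by (simp add: algebra_simps)
      then have "real m * (a + b) + (a + b) \<le> 2 * (c * real j + real j * (real J - real j))"
        using \<open>a \<le> 1\<close> \<open>b \<le> 1\<close> by argo
      then have "real (Suc m) * ((a + b) / 2) \<le> real m * real j / real J + real j * (real J - real j)"
        unfolding c by (simp add: distrib_right)
      also have "\<dots> \<le> real (Suc m) * real j / real J + real j * (real J - real j)"
        using assms by (simp add: divide_right_mono mult_right_mono)
      finally show ?thesis unfolding w .
    qed
  qed
qed

text \<open>With \<open>J\<close> near the square root of \<open>m\<close> this is Erdos' order 1 /
  sqrt m, with no estimate of binomial coefficients. \<open>J\<close> stays free because in the
  application only a lower bound on \<open>m\<close> is known.\<close>

corollary walk_count_one_bound:
  assumes "0 < J" "0 < m"
  shows "real (walk_count m 1) / 2 ^ m \<le> 1 / real J + real J / real m"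
proof -
  have "real m * (real (walk_count m 1) / 2 ^ m) \<le> real m / real J + real J"
    using walk_count_bound[of J 1 m] assms by simp
  then show ?thesis using assms(2) by (simp add: field_simps)
qed

lemma card_Pow_insert_filter:
  assumes "finite K" "x \<notin> K"
  shows "card {X \<in> Pow (insert x K). Q X} = card {X \<in> Pow K. Q X} + card {X \<in> Pow K. Q (insert x X)}"
proof -
  have eq: "{X \<in> Pow (insert x K). Q X} = {X \<in> Pow K. Q X} \<union> insert x ` {X \<in> Pow K. Q (insert x X)}"
    by (auto simp: Pow_insert)
  have inj: "inj_on (insert x) {X \<in> Pow K. Q (insert x X)}"
    using assms(2) by (intro inj_onI) (metis (no_types, lifting) Diff_insert_absorb PowD mem_Collect_eq subsetD)
  have "finite {X \<in> Pow K. P X}" for P using assms(1) by simp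
  moreover have "{X \<in> Pow K. Q X} \<inter> insert x ` {X \<in> Pow K. Q (insert x X)} = {}" using assms(2) by auto
  ultimately show ?thesis
    unfolding eq by (simp only: card_Un_disjoint finite_imageI card_image[OF inj])
qed

text \<open>Splitting on a nonzero term \<open>s x\<close> leads to the sets \<open>A\<close> and \<open>A - s x\<close>. The shifted set contains
  a point outside \<open>A\<close>; moving it over gives sets of sizes \<open>card A + 1\<close> and \<open>card A - 1\<close>.\<close>

lemma subset_sum_concentration:
  fixes s :: "'a \<Rightarrow> 'b :: linordered_ab_group_add"
  assumes "finite K" "finite A"
  shows "card {X \<in> Pow K. sum s X \<in> A}
    \<le> 2 ^ card {i \<in> K. s i = 0} * walk_count (card {i \<in> K. s i \<noteq> 0}) (card A)"
  using assms
proof (induction K arbitrary: A rule: finite_induct)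
  case empty
  show ?case
  proof (cases "card A")
    case 0
    then show ?thesis using empty by simp
  next
    case (Suc j)
    have "{X. X = {} \<and> sum s X \<in> A} \<subseteq> {{}}" by auto
    then have "card {X. X = {} \<and> sum s X \<in> A} \<le> card {{} :: 'a set}" by (intro card_mono) auto
    then show ?thesis using Suc by simp
  qed
next
  case (insert x K)
  define N where "N B = card {X \<in> Pow K. sum s X \<in> B}" for B
  define A' where "A' = (\<lambda>a. a - s x) ` A"
  have fA': "finite A'" and cA': "card A' = card A"
    using insert.prems by (auto simp: A'_def intro: card_image inj_onI)
  have "{X \<in> Pow K. sum s (insert x X) \<in> A} = {X \<in> Pow K. sum s X \<in> A'}"
  proof (intro Collect_cong conj_cong refl)
    fix X assume X: "X \<in> Pow K"
    then have "sum s (insert x X) = s x + sum s X"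
      using insert.hyps by (meson PowD finite_subset subsetD sum.insert)
    then show "(sum s (insert x X) \<in> A) = (sum s X \<in> A')"
      by (force simp: A'_def image_iff algebra_simps)
  qed
  then have split: "card {X \<in> Pow (insert x K). sum s X \<in> A} = N A + N A'"
    unfolding N_def using card_Pow_insert_filter[OF insert.hyps(1,2), of "\<lambda>X. sum s X \<in> A"] by simp
  show ?case
  proof (cases "s x = 0")
    case True
    have "A' = A" by (simp add: A'_def True)
    have sets: "{i \<in> insert x K. s i = 0} = insert x {i \<in> K. s i = 0}"
      "{i \<in> insert x K. s i \<noteq> 0} = {i \<in> K. s i \<noteq> 0}" using True by auto
    show ?thesis
      unfolding split sets using insert.IH[OF insert.prems] insert.hyps \<open>A' = A\<close>
      by (simp add: N_def)
  next
    case False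
    have sets: "{i \<in> insert x K. s i \<noteq> 0} = insert x {i \<in> K. s i \<noteq> 0}"
      "{i \<in> insert x K. s i = 0} = {i \<in> K. s i = 0}" using False by auto
    show ?thesis
    proof (cases "A = {}")
      case True
      then show ?thesis by simp
    next
      case nonempty: False
      have "\<exists>y \<in> A'. y \<notin> A"
      proof (cases "s x > 0")
        case True
        have "Min A - s x \<notin> A"
          using True insert.prems by (metis Min_le diff_less_eq less_add_same_cancel1 not_le)
        then show ?thesis using nonempty insert.prems by (auto simp: A'_def intro!: bexI[of _ "Min A"] Min_in)
      next
        case False
        with \<open>s x \<noteq> 0\<close> have "s x < 0" by simp
        then have "Max A - s x \<notin> A"
          using insert.prems by (metis Max_ge add.right_neutral add_less_cancel_left diff_add_cancel not_le)
        then show ?thesis using nonempty insert.prems by (auto simp: A'_def intro!: bexI[of _ "Max A"] Max_in)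
      qed
      then obtain y where y: "y \<in> A'" "y \<notin> A" by blast
      have N_insert: "N (insert y B) = N B + N {y}" if "y \<notin> B" for B
      proof -
        have "{X \<in> Pow K. sum s X \<in> insert y B} = {X \<in> Pow K. sum s X \<in> B} \<union> {X \<in> Pow K. sum s X \<in> {y}}"
          by auto
        then show ?thesis
          unfolding N_def using that insert.hyps(1) by (simp only:, subst card_Un_disjoint) auto
      qed
      have "N A' = N (A' - {y}) + N {y}"
        using N_insert[of "A' - {y}"] y by (simp add: insert_absorb)
      moreover have "N (insert y A) = N A + N {y}" using N_insert[OF y(2)] .
      ultimately have "N A + N A' = N (insert y A) + N (A' - {y})" by simp
      moreover have "N (insert y A) \<le> 2 ^ card {i \<in> K. s i = 0} *
          walk_count (card {i \<in> K. s i \<noteq> 0}) (Suc (card A))"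
        using insert.IH[of "insert y A"] insert.prems y by (simp add: N_def)
      moreover have "N (A' - {y}) \<le> 2 ^ card {i \<in> K. s i = 0} *
          walk_count (card {i \<in> K. s i \<noteq> 0}) (card A - 1)"
        using insert.IH[of "A' - {y}"] fA' y cA' by (simp add: N_def)
      moreover obtain j where j: "card A = Suc j"
        using nonempty insert.prems by (metis card_eq_0_iff not0_implies_Suc)
      ultimately show ?thesis
        unfolding split sets using insert.hyps by (simp add: distrib_left)
    qed
  qed
qed

text \<open>Toggling \<open>i\<close> flips the parity of the sum, which pairs off the subsets of
  the two parities.\<close>

lemma card_Pow_even_sum:
  fixes s :: "'a \<Rightarrow> int"
  assumes "finite K" "i \<in> K" "odd (s i)"
  shows "2 * card {X \<in> Pow K. even (sum s X) = b} = 2 ^ card K"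
proof -
  define L where "L = K - {i}"
  have K: "K = insert i L" "finite L" "i \<notin> L" using assms by (auto simp: L_def)
  have "{X \<in> Pow L. even (sum s (insert i X)) = b} = {X \<in> Pow L. even (sum s X) \<noteq> b}"
  proof (intro Collect_cong conj_cong refl)
    fix X assume "X \<in> Pow L"
    then have "sum s (insert i X) = s i + sum s X"
      using K by (meson PowD finite_subset subsetD sum.insert)
    then show "(even (sum s (insert i X)) = b) = (even (sum s X) \<noteq> b)" using assms(3) by auto
  qed
  moreover have "card {X \<in> Pow L. even (sum s X) = b} + card {X \<in> Pow L. even (sum s X) \<noteq> b} = card (Pow L)"
    using K(2) by (subst card_Un_disjoint[symmetric]) (auto intro!: arg_cong[where f = card])
  ultimately have "card {X \<in> Pow K. even (sum s X) = b} = 2 ^ card L"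
    unfolding K(1) card_Pow_insert_filter[OF K(2,3)] using K(2) by (simp add: card_Pow)
  then show ?thesis using K by simp
qed

section \<open>Random subsets of fixed size\<close>

text \<open>Rows are represented by their supports; \<open>random_zero_one_mat_incidence\<close>
  makes the link with vectors.\<close>

definition subsets_of_card :: "nat \<Rightarrow> nat \<Rightarrow> nat set set" where
  "subsets_of_card n d = {R. R \<subseteq> {..<n} \<and> card R = d}"

lemma finite_subsets_of_card [simp]: "finite (subsets_of_card n d)"
  by (rule finite_subset[of _ "Pow {..<n}"]) (auto simp: subsets_of_card_def)

lemma card_subsets_of_card: "card (subsets_of_card n d) = n choose d"
  using n_subsets[of "{..<n}" d] by (simp add: subsets_of_card_def)

lemma subsets_of_card_nonempty: "d \<le> n \<Longrightarrow> subsets_of_card n d \<noteq> {}"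
  using card_subsets_of_card[of n d] by (metis binomial_eq_0_iff card.empty not_le)

lemma card_subsets_prescribed:
  assumes "A \<subseteq> {..<n}" "B \<subseteq> {..<n}" "A \<inter> B = {}" "card A \<le> d"
  shows "card {R \<in> subsets_of_card n d. A \<subseteq> R \<and> B \<inter> R = {}} = (n - card A - card B) choose (d - card A)"
proof -
  define V where "V = {..<n} - A - B"
  have fin: "finite A" "finite B" using assms(1,2) finite_subset by blast+
  have "card V = card {..<n} - card A - card B"
    unfolding V_def using assms fin by (subst card_Diff_subset, blast, blast, subst card_Diff_subset) auto
  then have V: "finite V" "card V = n - card A - card B"
    by (simp_all add: V_def)
  have "bij_betw (\<lambda>S. A \<union> S) {S. S \<subseteq> V \<and> card S = d - card A}
      {R \<in> subsets_of_card n d. A \<subseteq> R \<and> B \<inter> R = {}}"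
  proof (rule bij_betw_byWitness[where f' = "\<lambda>R. R - A"])
    show "\<forall>S\<in>{S. S \<subseteq> V \<and> card S = d - card A}. (A \<union> S) - A = S" by (auto simp: V_def)
    show "\<forall>R\<in>{R \<in> subsets_of_card n d. A \<subseteq> R \<and> B \<inter> R = {}}. A \<union> (R - A) = R" by auto
    show "(\<union>) A ` {S. S \<subseteq> V \<and> card S = d - card A}
        \<subseteq> {R \<in> subsets_of_card n d. A \<subseteq> R \<and> B \<inter> R = {}}"
    proof (clarsimp, intro conjI)
      fix S assume S: "S \<subseteq> V" "card S = d - card A"
      have "card (A \<union> S) = card A + card S"
        using S V fin by (intro card_Un_disjoint) (auto simp: V_def intro: finite_subset)
      then show "A \<union> S \<in> subsets_of_card n d"
        using S assms by (auto simp: subsets_of_card_def V_def)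
      show "B \<inter> (A \<union> S) = {}" using S assms by (auto simp: V_def)
    qed
    show "(\<lambda>R. R - A) ` {R \<in> subsets_of_card n d. A \<subseteq> R \<and> B \<inter> R = {}} \<subseteq> {S. S \<subseteq> V \<and> card S = d - card A}"
      using fin by (auto simp: V_def subsets_of_card_def card_Diff_subset)
  qed
  then have "card {R \<in> subsets_of_card n d. A \<subseteq> R \<and> B \<inter> R = {}} = card {S. S \<subseteq> V \<and> card S = d - card A}"
    by (rule bij_betw_same_card[symmetric])
  then show ?thesis using n_subsets[OF V(1)] V(2) by simp
qed

text \<open>Both sides count the triples of a \<open>d\<close>-subset, a point inside it and a point
  outside it.\<close>

lemma binomial_drop_two:
  assumes "1 \<le> d" "d < n"
  shows "n * (n - 1) * ((n - 2) choose (d - 1)) = d * (n - d) * (n choose d)"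
proof -
  obtain e where e: "d = Suc e" using assms(1) by (cases d) auto
  obtain m where m: "n = Suc (Suc m)" using assms by (metis One_nat_def add_2_eq_Suc less_iff_Suc_add nat_le_iff_add plus_1_eq_Suc add_Suc)
  have "Suc e * (Suc m - e) * (Suc (Suc m) choose Suc e) = (Suc m - e) * (Suc e * (Suc (Suc m) choose Suc e))"
    by (simp only: mult_ac)
  also have "\<dots> = Suc (Suc m) * ((Suc m - e) * (Suc m choose e))"
    by (simp only: Suc_times_binomial mult.left_commute)
  also have "(Suc m - e) * (Suc m choose e) = Suc m * (m choose e)"
    using binomial_absorb_comp[of "Suc m" e] by simp
  finally have "Suc e * (Suc m - e) * (Suc (Suc m) choose Suc e) = Suc (Suc m) * Suc m * (m choose e)"
    by (simp only: mult.assoc)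
  moreover have "n - 2 = m" "n - 1 = Suc m" "d - 1 = e" "n - d = Suc m - e" using e m by simp_all
  ultimately show ?thesis unfolding e m by (simp only: diff_Suc_1 diff_Suc_Suc)
qed

text \<open>The pairs \<open>{i, f i}\<close>, \<open>i \<in> K\<close>, are disjoint. Swapping the two points of any subfamily of the pairs
  preserves the uniform distribution on the \<open>d\<close>-subsets, so the statistics of a random subset may be
  averaged over all swaps; only pairs met by the subset in exactly one point matter.\<close>

locale matching =
  fixes n :: nat and K :: "nat set" and f :: "nat \<Rightarrow> nat"
  assumes K_sub: "K \<subseteq> {..<n}" and f_sub: "f ` K \<subseteq> {..<n}"
    and inj_f: "inj_on f K" and disj: "f ` K \<inter> K = {}"
begin

lemma finite_K: "finite K" using K_sub finite_subset by blast

definition swap :: "nat set \<Rightarrow> nat \<Rightarrow> nat" where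
  "swap X j = (if j \<in> X then f j else if j \<in> f ` X then inv_into X f j else j)"

definition split :: "nat set \<Rightarrow> nat set" where
  "split R = {i \<in> K. (i \<in> R) \<noteq> (f i \<in> R)}"

text \<open>Change of the sum of \<open>y\<close> over \<open>R\<close> when the pair of
  \<open>i\<close> is swapped. It vanishes unless the pair is split, and is then the difference of
  the two values of \<open>y\<close> up to sign.\<close>

definition coef :: "(nat \<Rightarrow> int) \<Rightarrow> nat set \<Rightarrow> nat \<Rightarrow> int" where
  "coef y R i = (of_bool (i \<in> R) - of_bool (f i \<in> R)) * (y (f i) - y i)"

lemma swap_partner: "X \<subseteq> K \<Longrightarrow> i \<in> X \<Longrightarrow> swap X (f i) = i"
  using disj inj_f by (auto simp: swap_def inj_on_subset intro!: inv_into_f_f dest: inj_on_subset)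

lemma swap_swap: assumes "X \<subseteq> K" shows "swap X (swap X j) = j"
proof -
  consider "j \<in> X" | i where "i \<in> X" "j = f i" "j \<notin> X" | "j \<notin> X" "j \<notin> f ` X" by blast
  then show ?thesis
  proof cases
    case 1 then show ?thesis using swap_partner[OF assms 1] by (simp add: swap_def)
  next
    case 2 then show ?thesis using swap_partner[OF assms, of i] by (simp add: swap_def)
  next
    case 3 then show ?thesis by (simp add: swap_def)
  qed
qed

lemma inj_swap: "X \<subseteq> K \<Longrightarrow> inj (swap X)"
  by (metis injI swap_swap)

lemma swap_less: assumes "X \<subseteq> K" "j < n" shows "swap X j < n"
proof (cases "j \<in> f ` X")
  case True
  then show ?thesis using swap_partner[OF assms(1)] assms K_sub by auto
next
  case False
  then show ?thesis using assms f_sub by (auto simp: swap_def)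
qed

lemma swap_image_subsets:
  assumes "X \<subseteq> K" "R \<in> subsets_of_card n d"
  shows "swap X ` R \<in> subsets_of_card n d"
  using assms swap_less[OF assms(1)] card_image[OF inj_on_subset[OF inj_swap[OF assms(1)]], of R]
  by (auto simp: subsets_of_card_def)

text \<open>The pairs are disjoint, so the effects of their swaps add up.\<close>

lemma sum_swap:
  assumes X: "X \<subseteq> K" and R: "R \<subseteq> {..<n}"
  shows "sum y (swap X ` R) = sum y R + sum (coef y R) X"
proof -
  define g where "g j = of_bool (j \<in> R) * (y (swap X j) - y j)" for j
  have finX: "finite X" using X finite_K finite_subset by blast
  have "sum y (swap X ` R) - sum y R = (\<Sum>j\<in>R. y (swap X j) - y j)"
    using inj_on_subset[OF inj_swap[OF X]] by (simp add: sum.reindex sum_subtractf)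
  also have "\<dots> = sum g {..<n}"
    using R by (intro sum.mono_neutral_cong_left) (auto simp: g_def)
  also have "\<dots> = sum g (X \<union> f ` X)"
    using X K_sub f_sub by (intro sum.mono_neutral_right) (auto simp: g_def swap_def)
  also have "\<dots> = sum g X + sum g (f ` X)"
    using X disj finX by (intro sum.union_disjoint) auto
  also have "sum g (f ` X) = (\<Sum>i\<in>X. g (f i))"
    using inj_on_subset[OF inj_f X] by (simp add: sum.reindex)
  also have "sum g X + (\<Sum>i\<in>X. g (f i)) = sum (coef y R) X"
    unfolding sum.distrib[symmetric]
    by (intro sum.cong refl) (simp add: g_def swap_partner[OF X], simp add: coef_def swap_def)
  finally show ?thesis by simp
qed

text \<open>Double count of the pairs \<open>(R, X)\<close>: for fixed \<open>X\<close>, taking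
  images under \<open>swap X\<close> permutes the \<open>d\<close>-subsets. For fixed
  \<open>R\<close> a subset-sum problem with the terms \<open>coef y R\<close> is left, to which
  Littlewood-Offord estimates apply.\<close>

lemma swap_average:
  "2 ^ card K * card {R \<in> subsets_of_card n d. P (sum y R)}
    = (\<Sum>R\<in>subsets_of_card n d. card {X \<in> Pow K. P (sum y R + sum (coef y R) X)})"
proof -
  let ?S = "subsets_of_card n d"
  have "(\<Sum>R\<in>?S. card {X \<in> Pow K. P (sum y R + sum (coef y R) X)})
      = (\<Sum>R\<in>?S. \<Sum>X\<in>Pow K. of_bool (P (sum y R + sum (coef y R) X)))"
    using finite_K by (simp add: Collect_conj_eq Pow_def)
  also have "\<dots> = (\<Sum>X\<in>Pow K. \<Sum>R\<in>?S. of_bool (P (sum y R + sum (coef y R) X)))"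
    by (rule sum.swap)
  also have "\<dots> = (\<Sum>X\<in>Pow K. card {R \<in> ?S. P (sum y R)})"
  proof (rule sum.cong)
    fix X assume X: "X \<in> Pow K"
    have "(\<Sum>R\<in>?S. of_bool (P (sum y R + sum (coef y R) X))) = (\<Sum>R\<in>?S. of_bool (P (sum y (swap X ` R))))"
      using X by (intro sum.cong refl) (simp add: sum_swap subsets_of_card_def)
    also have "\<dots> = (\<Sum>R\<in>?S. of_bool (P (sum y R)))"
      using X swap_image_subsets
      by (intro sum.reindex_bij_witness[of _ "\<lambda>R. swap X ` R" "\<lambda>R. swap X ` R"])
         (auto simp: image_image swap_swap)
    also have "\<dots> = card {R \<in> ?S. P (sum y R)}"
      by (simp add: Collect_conj_eq)
    finally show "(\<Sum>R\<in>?S. of_bool (P (sum y R + sum (coef y R) X))) = card {R \<in> ?S. P (sum y R)}" .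
  qed simp
  also have "\<dots> = 2 ^ card K * card {R \<in> ?S. P (sum y R)}"
    using finite_K by (simp add: card_Pow)
  finally show ?thesis by simp
qed

section \<open>Moments of the number of split pairs\<close>

lemma card_split_one:
  assumes "i \<in> K" "1 \<le> d"
  shows "card {R \<in> subsets_of_card n d. i \<in> split R} = 2 * ((n - 2) choose (d - 1))"
proof -
  let ?S = "subsets_of_card n d"
  have ne: "f i \<noteq> i" "i < n" "f i < n" using assms disj K_sub f_sub by auto
  define E where "E a b = {R \<in> ?S. {a} \<subseteq> R \<and> {b} \<inter> R = {}}" for a b
  have E: "card (E a b) = (n - 2) choose (d - 1)" if "a \<noteq> b" "a < n" "b < n" for a b
    unfolding E_def using that assms(2) by (subst card_subsets_prescribed) (auto simp: numeral_2_eq_2)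
  have "{R \<in> ?S. i \<in> split R} = E i (f i) \<union> E (f i) i"
    using assms by (auto simp: split_def E_def)
  moreover have "E i (f i) \<inter> E (f i) i = {}" by (auto simp: E_def)
  moreover have "finite (E a b)" for a b by (simp add: E_def)
  ultimately have "card {R \<in> ?S. i \<in> split R} = card (E i (f i)) + card (E (f i) i)"
    by (simp only: card_Un_disjoint)
  then show ?thesis using ne by (simp add: E)
qed

lemma card_split_two:
  assumes "i \<in> K" "j \<in> K" "i \<noteq> j" "2 \<le> d"
  shows "card {R \<in> subsets_of_card n d. i \<in> split R \<and> j \<in> split R} = 4 * ((n - 4) choose (d - 2))"
proof -
  let ?S = "subsets_of_card n d"
  have ne: "f i \<noteq> i" "i < n" "f i < n" "f j \<noteq> j" "j < n" "f j < n" "f i \<noteq> j" "f j \<noteq> i" "f i \<noteq> f j"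
    using assms disj K_sub f_sub inj_f by (auto simp: inj_on_def)
  define E where "E a b c e = {R \<in> ?S. {a, b} \<subseteq> R \<and> {c, e} \<inter> R = {}}" for a b c e
  have E: "card (E a b c e) = (n - 4) choose (d - 2)" if "distinct [a, b, c, e]" "{a, b, c, e} \<subseteq> {..<n}" for a b c e
    unfolding E_def using that assms by (subst card_subsets_prescribed) (auto simp: numeral_eq_Suc)
  have fin: "finite (E a b c e)" for a b c e by (simp add: E_def)
  have eq: "{R \<in> ?S. i \<in> split R \<and> j \<in> split R} =
      E i j (f i) (f j) \<union> (E i (f j) (f i) j \<union> (E (f i) j i (f j) \<union> E (f i) (f j) i j))"
    using assms by (auto simp: split_def E_def)
  have disjoint: "E i j (f i) (f j) \<inter> (E i (f j) (f i) j \<union> (E (f i) j i (f j) \<union> E (f i) (f j) i j)) = {}"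
    "E i (f j) (f i) j \<inter> (E (f i) j i (f j) \<union> E (f i) (f j) i j) = {}"
    "E (f i) j i (f j) \<inter> E (f i) (f j) i j = {}"
    by (auto simp: E_def)
  have "card {R \<in> ?S. i \<in> split R \<and> j \<in> split R} =
      card (E i j (f i) (f j)) + (card (E i (f j) (f i) j) + (card (E (f i) j i (f j)) + card (E (f i) (f j) i j)))"
    unfolding eq using disjoint by (simp only: card_Un_disjoint fin finite_Un simp_thms)
  also have "\<dots> = 4 * ((n - 4) choose (d - 2))"
    using ne assms by (simp add: E)
  finally show ?thesis .
qed

end

text \<open>Probability that a uniform \<open>d\<close>-subset contains exactly one of two given
  distinct points.\<close>

definition split_prob :: "nat \<Rightarrow> nat \<Rightarrow> real" where
  "split_prob n d = 2 * real d * real (n - d) / (real n * real (n - 1))"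

lemma binomial_drop_two_real:
  assumes "1 \<le> d" "d < n"
  shows "2 * real ((n - 2) choose (d - 1)) = real (n choose d) * split_prob n d"
proof -
  have "real n * real (n - 1) * real ((n - 2) choose (d - 1)) = real d * real (n - d) * real (n choose d)"
    unfolding of_nat_mult[symmetric] binomial_drop_two[OF assms] ..
  moreover have "real n * real (n - 1) \<noteq> 0" using assms by simp
  ultimately show ?thesis unfolding split_prob_def by (simp add: field_simps del: of_nat_diff)
qed

lemma split_prob_pos: "1 \<le> d \<Longrightarrow> d < n \<Longrightarrow> 0 < split_prob n d"
  unfolding split_prob_def by simp

text \<open>Two disjoint pairs split almost independently: one split pair leaves a
  \<open>(d - 1)\<close>-subset of \<open>n - 2\<close> points, so
  \<open>binomial_drop_two_real\<close> applies twice. The small relative error 8 / n keeps the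
  variance far below the squared mean.\<close>

lemma binomial_drop_four_real:
  assumes "2 \<le> d" "d + 2 \<le> n" "7 \<le> n"
  shows "4 * real ((n - 4) choose (d - 2)) \<le> real (n choose d) * (split_prob n d)\<^sup>2 * (1 + 8 / real n)"
proof -
  define N q where "N = real (n choose d)" and "q = split_prob n d"
  have q: "0 < q" unfolding q_def using assms by (intro split_prob_pos) auto
  have "2 * real ((n - 4) choose (d - 2)) = real ((n - 2) choose (d - 1)) * split_prob (n - 2) (d - 1)"
    using binomial_drop_two_real[of "d - 1" "n - 2"] assms by (simp add: numeral_eq_Suc)
  then have "4 * real ((n - 4) choose (d - 2)) = N * q * split_prob (n - 2) (d - 1)"
    using binomial_drop_two_real[of d n] assms unfolding N_def q_def by (simp add: mult.assoc flip: binomial_drop_two_real)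
  also have "\<dots> \<le> N * q * (q * (1 + 8 / real n))"
  proof (rule mult_left_mono)
    define x where "x = real n"
    have x: "x \<ge> 7" using assms by (simp add: x_def)
    have "real (d - 1) * real (n - d - 1) \<le> real d * real (n - d)"
      by (intro mult_mono) auto
    then have "2 * real (d - 1) * real (n - d - 1) / ((x - 2) * (x - 3)) \<le> 2 * real d * real (n - d) / ((x - 2) * (x - 3))"
      using x by (intro divide_right_mono) auto
    moreover have "n - 2 - (d - 1) = n - d - 1" "real (n - 2) = x - 2" "real (n - 2 - 1) = x - 3"
      using assms by (auto simp: x_def)
    ultimately have "split_prob (n - 2) (d - 1) \<le> 2 * real d * real (n - d) / ((x - 2) * (x - 3))"
      unfolding split_prob_def by (simp only:)
    also have "\<dots> = q * (x * (x - 1) / ((x - 2) * (x - 3)))"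
    proof -
      have "real n * real (n - 1) = x * (x - 1)" "x * (x - 1) \<noteq> 0" using assms by (auto simp: x_def)
      then show ?thesis unfolding q_def split_prob_def by simp
    qed
    also have "\<dots> \<le> q * (1 + 8 / x)"
    proof (rule mult_left_mono)
      \<comment> \<open>Clearing denominators in the goal leaves
        \<open>34 * x \<le> 48 + 4 * (x * x)\<close>, whose sides differ by this product plus 6. The
        hypothesis \<open>7 \<le> n\<close> makes the product nonnegative.\<close>
      have "0 \<le> (4 * x - 6) * (x - 7)" using x by simp
      then have "34 * x \<le> 48 + 4 * (x * x)" by (simp add: algebra_simps)
      then show "x * (x - 1) / ((x - 2) * (x - 3)) \<le> 1 + 8 / x"
        using x by (simp add: divide_simps) (simp add: algebra_simps)
    qed (use q in simp)
    finally show "split_prob (n - 2) (d - 1) \<le> q * (1 + 8 / real n)" by (simp add: x_def)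
  qed (use q in \<open>simp add: N_def\<close>)
  finally show ?thesis by (simp add: N_def q_def power2_eq_square mult_ac)
qed

context matching
begin

lemma split_subset: "split R \<subseteq> K" by (auto simp: split_def)

lemma finite_split: "finite (split R)" using split_subset finite_K finite_subset by blast

lemma real_card_split: "real (card (split R)) = (\<Sum>i\<in>K. of_bool (i \<in> split R))"
  using finite_K split_subset by (simp add: Int_absorb1 Int_commute)

lemma sum_card_split:
  assumes "2 \<le> d" "d + 2 \<le> n"
  shows "(\<Sum>R\<in>subsets_of_card n d. real (card (split R))) = real (n choose d) * (real (card K) * split_prob n d)"
proof -
  have "(\<Sum>R\<in>subsets_of_card n d. real (card (split R)))
      = (\<Sum>i\<in>K. \<Sum>R\<in>subsets_of_card n d. of_bool (i \<in> split R))"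
    unfolding real_card_split by (rule sum.swap)
  also have "\<dots> = (\<Sum>i\<in>K. real (2 * ((n - 2) choose (d - 1))))"
  proof (rule sum.cong)
    fix i assume "i \<in> K"
    then show "(\<Sum>R\<in>subsets_of_card n d. of_bool (i \<in> split R)) = real (2 * ((n - 2) choose (d - 1)))"
      using assms by (simp only: card_split_one[symmetric]) (simp add: Collect_conj_eq)
  qed simp
  also have "\<dots> = real (n choose d) * (real (card K) * split_prob n d)"
    using binomial_drop_two_real[of d n] assms by simp
  finally show ?thesis .
qed

lemma sum_card_split_squared:
  assumes "2 \<le> d" "d + 2 \<le> n" "7 \<le> n"
  shows "(\<Sum>R\<in>subsets_of_card n d. (real (card (split R)))\<^sup>2)
    \<le> real (n choose d) * (real (card K) * split_prob n d + (real (card K) * split_prob n d)\<^sup>2 * (1 + 8 / real n))"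
proof -
  let ?S = "subsets_of_card n d" and ?k = "real (card K)"
  define N q where "N = real (n choose d)" and "q = split_prob n d"
  have bound: "(\<Sum>R\<in>?S. of_bool (i \<in> split R) * of_bool (j \<in> split R))
      \<le> of_bool (i = j) * (N * q) + N * q\<^sup>2 * (1 + 8 / real n)" (is "?lhs \<le> ?rhs")
    if "i \<in> K" "j \<in> K" for i j
  proof -
    have lhs: "?lhs = real (card {R \<in> ?S. i \<in> split R \<and> j \<in> split R})"
      by (simp add: Collect_conj_eq flip: of_bool_conj)
    show ?thesis
    proof (cases "i = j")
      case True
      have "real (card {R \<in> ?S. i \<in> split R \<and> j \<in> split R}) = N * q"
        using True that assms binomial_drop_two_real[of d n] by (simp add: card_split_one N_def q_def)
      then show ?thesis using True unfolding lhs by (simp add: N_def)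
    next
      case False
      have "real (card {R \<in> ?S. i \<in> split R \<and> j \<in> split R}) = 4 * real ((n - 4) choose (d - 2))"
        using False that assms by (simp add: card_split_two)
      then show ?thesis using False binomial_drop_four_real[OF assms] unfolding lhs by (simp add: N_def q_def)
    qed
  qed
  have "(\<Sum>R\<in>?S. (real (card (split R)))\<^sup>2)
      = (\<Sum>R\<in>?S. \<Sum>i\<in>K. \<Sum>j\<in>K. of_bool (i \<in> split R) * of_bool (j \<in> split R))"
    unfolding real_card_split power2_eq_square sum_product ..
  also have "\<dots> = (\<Sum>i\<in>K. \<Sum>R\<in>?S. \<Sum>j\<in>K. of_bool (i \<in> split R) * of_bool (j \<in> split R))"
    by (rule sum.swap)
  also have "\<dots> = (\<Sum>i\<in>K. \<Sum>j\<in>K. \<Sum>R\<in>?S. of_bool (i \<in> split R) * of_bool (j \<in> split R))"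
    by (intro sum.cong refl sum.swap)
  also have "\<dots> \<le> (\<Sum>i\<in>K. \<Sum>j\<in>K. of_bool (i = j) * (N * q) + N * q\<^sup>2 * (1 + 8 / real n))"
    by (intro sum_mono bound)
  also have "\<dots> = (\<Sum>i\<in>K. N * q + ?k * (N * q\<^sup>2 * (1 + 8 / real n)))"
  proof (rule sum.cong)
    fix i assume "i \<in> K"
    then have "(\<Sum>j\<in>K. of_bool (i = j) * (N * q)) = N * q"
      using finite_K by (simp add: of_bool_def if_distrib[of "\<lambda>x. x * _"] cong: if_cong)
    then show "(\<Sum>j\<in>K. of_bool (i = j) * (N * q) + N * q\<^sup>2 * (1 + 8 / real n)) = N * q + ?k * (N * q\<^sup>2 * (1 + 8 / real n))"
      by (simp add: sum.distrib)
  qed simp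
  also have "\<dots> = N * (?k * q + (?k * q)\<^sup>2 * (1 + 8 / real n))"
    by (simp add: algebra_simps power2_eq_square)
  finally show ?thesis by (simp add: N_def q_def)
qed

text \<open>Second moment method: by Cauchy-Schwarz a nonnegative count is positive with probability
  at least (mean)^2 / (second moment). Since \<open>8 \<le> n\<close> makes 1 + 8 / n at most 2,
  this is at least m / (1 + 2 m), which remains of order m for small m.\<close>

lemma card_split_nonempty:
  assumes "2 \<le> d" "d + 2 \<le> n" "8 \<le> n"
  defines "m \<equiv> real (card K) * split_prob n d"
  shows "real (n choose d) * (m / (1 + 2 * m)) \<le> real (card {R \<in> subsets_of_card n d. split R \<noteq> {}})"
proof (cases "K = {}")
  case True
  then show ?thesis by (simp add: m_def)
next
  case False
  let ?S = "subsets_of_card n d"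
  define N where "N = real (n choose d)"
  have N: "N > 0" using assms by (simp add: N_def)
  have m: "m > 0"
    unfolding m_def using False finite_K split_prob_pos[of d n] assms by (simp add: card_gt_0_iff)
  have "(N * m)\<^sup>2 = (\<Sum>R\<in>?S. real (card (split R)) * of_bool (split R \<noteq> {}))\<^sup>2"
    unfolding N_def m_def sum_card_split[OF assms(1,2), symmetric]
    by (intro arg_cong[where f = "\<lambda>x. x\<^sup>2"] sum.cong) auto
  also have "\<dots> \<le> (\<Sum>R\<in>?S. (real (card (split R)))\<^sup>2) * (\<Sum>R\<in>?S. (of_bool (split R \<noteq> {}))\<^sup>2)"
    by (rule Cauchy_Schwarz_ineq_sum)
  also have "(\<Sum>R\<in>?S. (of_bool (split R \<noteq> {}))\<^sup>2) = real (card {R \<in> ?S. split R \<noteq> {}})"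
    by (simp add: Collect_conj_eq power2_eq_square flip: of_bool_conj)
  also have "(\<Sum>R\<in>?S. (real (card (split R)))\<^sup>2) \<le> N * (m + m\<^sup>2 * (1 + 8 / real n))"
    unfolding N_def m_def using assms by (intro sum_card_split_squared) auto
  also have "\<dots> \<le> N * (m + m\<^sup>2 * 2)"
    using N assms by (intro mult_left_mono add_left_mono) (auto simp: field_simps)
  finally have "(N * m)\<^sup>2 \<le> N * (m + m\<^sup>2 * 2) * real (card {R \<in> ?S. split R \<noteq> {}})"
    by (simp add: mult_right_mono)
  then have "N * m * (N * m) \<le> N * m * ((1 + 2 * m) * real (card {R \<in> ?S. split R \<noteq> {}}))"
    by (simp add: power2_eq_square algebra_simps)
  then have "N * m \<le> (1 + 2 * m) * real (card {R \<in> ?S. split R \<noteq> {}})"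
    using N m by simp
  then show ?thesis using m by (simp add: N_def field_simps)
qed

text \<open>Chebyshev's inequality at half the mean: the variance is at most m + 8 m^2 / n, and
  division by (m / 2)^2 gives the two terms.\<close>

lemma card_split_small:
  assumes "2 \<le> d" "d + 2 \<le> n" "8 \<le> n" "K \<noteq> {}"
  defines "m \<equiv> real (card K) * split_prob n d"
  shows "real (card {R \<in> subsets_of_card n d. real (card (split R)) < m / 2})
    \<le> real (n choose d) * (4 / m + 32 / real n)"
proof -
  let ?S = "subsets_of_card n d" and ?B = "{R \<in> subsets_of_card n d. real (card (split R)) < m / 2}"
  define N where "N = real (n choose d)"
  have N: "N > 0" using assms by (simp add: N_def)
  have m: "m > 0"
    unfolding m_def using assms finite_K split_prob_pos[of d n] by (simp add: card_gt_0_iff)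
  have "real (card ?B) * (m / 2)\<^sup>2 = (\<Sum>R\<in>?B. (m / 2)\<^sup>2)" by simp
  also have "\<dots> \<le> (\<Sum>R\<in>?B. (real (card (split R)) - m)\<^sup>2)"
    using m by (intro sum_mono) (auto simp flip: abs_le_square_iff)
  also have "\<dots> \<le> (\<Sum>R\<in>?S. (real (card (split R)) - m)\<^sup>2)"
    by (intro sum_mono2) auto
  also have "\<dots> = (\<Sum>R\<in>?S. (real (card (split R)))\<^sup>2) - 2 * m * (\<Sum>R\<in>?S. real (card (split R))) + N * m\<^sup>2"
    by (simp add: power2_diff sum.distrib sum_subtractf sum_distrib_left N_def card_subsets_of_card mult_ac)
  also have "\<dots> \<le> N * (m + m\<^sup>2 * (1 + 8 / real n)) - 2 * m * (N * m) + N * m\<^sup>2"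
    using sum_card_split_squared[of d] sum_card_split[of d] assms(1-3) by (simp add: N_def m_def)
  also have "\<dots> = N * (4 / m + 32 / real n) * (m / 2)\<^sup>2"
    using m assms by (simp add: field_simps power2_eq_square)
  finally show ?thesis
    using m by (simp add: N_def)
qed

text \<open>Given a split pair, the random swaps make the parity uniform; without one the trivial
  bound 1 is used. So the probability is at most 1 minus half the probability that some pair is
  split.\<close>

lemma card_even_sum_le:
  fixes y :: "nat \<Rightarrow> int"
  assumes "2 \<le> d" "d + 2 \<le> n" "8 \<le> n" and odd: "\<And>i. i \<in> K \<Longrightarrow> odd (y (f i) - y i)"
  defines "m \<equiv> real (card K) * split_prob n d"
  shows "real (card {R \<in> subsets_of_card n d. even (sum y R) = b})
    \<le> real (n choose d) * (1 - m / (2 * (1 + 2 * m)))"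
proof -
  let ?S = "subsets_of_card n d"
  have "card {X \<in> Pow K. even (sum y R + sum (coef y R) X) = b} * 2 \<le> 2 ^ card K * (2 - of_bool (split R \<noteq> {}))" for R
  proof (cases "split R = {}")
    case True
    have "card {X \<in> Pow K. even (sum y R + sum (coef y R) X) = b} \<le> card (Pow K)"
      using finite_K by (intro card_mono) auto
    then show ?thesis using True finite_K by (simp add: card_Pow)
  next
    case False
    then obtain i where i: "i \<in> split R" by blast
    then have "i \<in> K" "odd (coef y R i)"
      using odd[of i] by (auto simp: split_def coef_def of_bool_def)
    moreover have "(even (sum y R + s) = b) = (even s = (even (sum y R) = b))" for s by auto
    ultimately show ?thesis
      using card_Pow_even_sum[OF finite_K, of i "coef y R" "even (sum y R) = b"] False by simp
  qed
  then have "(\<Sum>R\<in>?S. card {X \<in> Pow K. even (sum y R + sum (coef y R) X) = b} * 2)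
      \<le> (\<Sum>R\<in>?S. 2 ^ card K * (2 - of_bool (split R \<noteq> {})))"
    by (intro sum_mono)
  then have "2 ^ card K * (card {R \<in> ?S. even (sum y R) = b} * 2) \<le> 2 ^ card K * (\<Sum>R\<in>?S. 2 - of_bool (split R \<noteq> {}))"
    using swap_average[of d "\<lambda>s. even s = b" y] by (simp add: sum_distrib_left sum_distrib_right flip: mult.assoc)
  then have "card {R \<in> ?S. even (sum y R) = b} * 2 \<le> (\<Sum>R\<in>?S. 2 - of_bool (split R \<noteq> {}))"
    by simp
  then have "real (card {R \<in> ?S. even (sum y R) = b} * 2) \<le> real (\<Sum>R\<in>?S. 2 - of_bool (split R \<noteq> {}))"
    by (simp only: of_nat_le_iff)
  also have "\<dots> = (\<Sum>R\<in>?S. 2 - of_bool (split R \<noteq> {}))"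
    unfolding of_nat_sum by (intro sum.cong) auto
  also have "\<dots> = 2 * real (n choose d) - real (card {R \<in> ?S. split R \<noteq> {}})"
    by (simp add: sum_subtractf card_subsets_of_card Collect_conj_eq)
  also have "\<dots> \<le> 2 * real (n choose d) - real (n choose d) * (m / (1 + 2 * m))"
    using card_split_nonempty[of d] assms by simp
  finally have "2 * real (card {R \<in> ?S. even (sum y R) = b})
      \<le> 2 * real (n choose d) - real (n choose d) * (m / (1 + 2 * m))" by simp
  moreover have halve: "c \<le> N * (1 - z / 2)" if "2 * c \<le> 2 * N - N * z" for c N z :: real
    using that by (simp add: algebra_simps)
  moreover have "m / (2 * (1 + 2 * m)) = m / (1 + 2 * m) / 2" by simp
  ultimately show ?thesis by (metis halve)
qed

text \<open>Every split pair has a nonzero coefficient. Subsets with fewer than m / 2 split pairs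
  are charged in full, which costs 4 / m + 32 / n; for the others Erdos' bound over the swaps gives
  1 / J + 2 J / m.\<close>

lemma card_sum_eq_le:
  fixes y :: "nat \<Rightarrow> int"
  assumes "2 \<le> d" "d + 2 \<le> n" "8 \<le> n" "K \<noteq> {}" and ne: "\<And>i. i \<in> K \<Longrightarrow> y (f i) \<noteq> y i" and J: "0 < J"
  defines "m \<equiv> real (card K) * split_prob n d"
  shows "real (card {R \<in> subsets_of_card n d. sum y R = a})
    \<le> real (n choose d) * (4 / m + 32 / real n + 1 / real J + 2 * real J / m)"
proof -
  let ?S = "subsets_of_card n d"
  define B where "B = {R \<in> ?S. real (card (split R)) < m / 2}"
  define w where "w = 1 / real J + 2 * real J / m"
  have m: "m > 0"
    unfolding m_def using assms finite_K split_prob_pos[of d n] by (simp add: card_gt_0_iff)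
  have w: "0 \<le> w" using m by (simp add: w_def)
  have "real (card {X \<in> Pow K. sum y R + sum (coef y R) X = a}) \<le> 2 ^ card K * (of_bool (R \<in> B) + w)"
    if "R \<in> ?S" for R
  proof (cases "R \<in> B")
    case True
    have "card {X \<in> Pow K. sum y R + sum (coef y R) X = a} \<le> card (Pow K)"
      using finite_K by (intro card_mono) auto
    then have "real (card {X \<in> Pow K. sum y R + sum (coef y R) X = a}) \<le> 2 ^ card K * 1"
      using finite_K by (simp add: card_Pow)
    also have "\<dots> \<le> 2 ^ card K * (of_bool (R \<in> B) + w)"
      using True w by (intro mult_left_mono) auto
    finally show ?thesis .
  next
    case False
    define M where "M = card (split R)"
    have M: "m / 2 \<le> real M" using False that by (simp add: B_def M_def)
    have nz: "{i \<in> K. coef y R i \<noteq> 0} = split R"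
      using ne by (auto simp: split_def coef_def of_bool_def)
    have z: "{i \<in> K. coef y R i = 0} = K - split R" using nz by auto
    have cK: "card (K - split R) + M = card K"
      unfolding M_def using split_subset finite_split finite_K
      by (simp add: card_Diff_subset card_mono)
    have "card {X \<in> Pow K. sum (coef y R) X \<in> {a - sum y R}} \<le> 2 ^ card (K - split R) * walk_count M 1"
      using subset_sum_concentration[OF finite_K, of "{a - sum y R}" "coef y R"] unfolding nz z M_def by simp
    moreover have "{X \<in> Pow K. sum y R + sum (coef y R) X = a} = {X \<in> Pow K. sum (coef y R) X \<in> {a - sum y R}}"
      by auto
    ultimately have "real (card {X \<in> Pow K. sum y R + sum (coef y R) X = a}) \<le> real (2 ^ card (K - split R) * walk_count M 1)"
      by (simp only: of_nat_le_iff)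
    also have "\<dots> = 2 ^ card K * (real (walk_count M 1) / 2 ^ M)"
      unfolding cK[symmetric] power_add by simp
    also have "\<dots> \<le> 2 ^ card K * (1 / real J + real J / real M)"
      using J M m by (intro mult_left_mono walk_count_one_bound) auto
    also have "\<dots> \<le> 2 ^ card K * (of_bool (R \<in> B) + w)"
    proof -
      have "real J / real M \<le> real J / (m / 2)"
        using M m by (intro divide_left_mono) auto
      then show ?thesis by (simp add: w_def False mult.commute)
    qed
    finally show ?thesis .
  qed
  then have "(\<Sum>R\<in>?S. real (card {X \<in> Pow K. sum y R + sum (coef y R) X = a}))
      \<le> (\<Sum>R\<in>?S. 2 ^ card K * (of_bool (R \<in> B) + w))"
    by (intro sum_mono)
  also have "(\<Sum>R\<in>?S. real (card {X \<in> Pow K. sum y R + sum (coef y R) X = a}))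
      = 2 ^ card K * real (card {R \<in> ?S. sum y R = a})"
    using arg_cong[OF swap_average[of d "\<lambda>s. s = a" y], of real] by simp
  also have "(\<Sum>R\<in>?S. 2 ^ card K * (of_bool (R \<in> B) + w)) = 2 ^ card K * (real (card B) + real (n choose d) * w)"
    by (simp add: B_def card_subsets_of_card Collect_conj_eq sum.distrib flip: sum_distrib_left)
  finally have "real (card {R \<in> ?S. sum y R = a}) \<le> real (card B) + real (n choose d) * w"
    by simp
  also have "real (card B) \<le> real (n choose d) * (4 / m + 32 / real n)"
    unfolding B_def m_def using assms by (intro card_split_small) auto
  finally show ?thesis by (simp add: w_def algebra_simps)
qed

end

text \<open>Each point of \<open>T\<close> is matched with a point outside \<open>T\<close>, so the
  indicator of \<open>T\<close> differs by an odd number on every pair.\<close>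

lemma card_even_inter_le:
  assumes "2 \<le> d" "d + 2 \<le> n" "8 \<le> n" "T \<subseteq> {..<n}" "2 * card T \<le> n"
  defines "m \<equiv> real (card T) * split_prob n d"
  shows "real (card {R \<in> subsets_of_card n d. even (card (R \<inter> T)) = b})
    \<le> real (n choose d) * (1 - m / (2 * (1 + 2 * m)))"
proof -
  have fT: "finite T" using assms(4) finite_subset by blast
  have "card T \<le> card ({..<n} - T)"
    using assms(4,5) fT by (simp add: card_Diff_subset)
  then obtain f where f: "f ` T \<subseteq> {..<n} - T" "inj_on f T"
    using card_le_inj[OF fT, of "{..<n} - T"] by auto
  interpret matching n T f
    using assms(4) f by unfold_locales auto
  define y where "y j = (of_bool (j \<in> T) :: int)" for j
  have "sum y R = int (card (R \<inter> T))" if "R \<in> subsets_of_card n d" for R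
    using that finite_subset[of R "{..<n}"] by (simp add: y_def subsets_of_card_def)
  then have "{R \<in> subsets_of_card n d. even (card (R \<inter> T)) = b} = {R \<in> subsets_of_card n d. even (sum y R) = b}"
    by auto
  moreover have "odd (y (f i) - y i)" if "i \<in> T" for i
    using that f by (auto simp: y_def)
  ultimately show ?thesis
    unfolding m_def using card_even_sum_le[OF assms(1-3), of y b] by simp
qed

text \<open>Pairs of points with different values are removed as long as there are any; the rest is
  constant. A vector without a dominant value therefore has many pairs.\<close>

lemma maximal_matching:
  fixes y :: "'a \<Rightarrow> 'b"
  assumes "finite V"
  shows "\<exists>K f. K \<subseteq> V \<and> f ` K \<subseteq> V \<and> inj_on f K \<and> f ` K \<inter> K = {} \<and> (\<forall>i\<in>K. y (f i) \<noteq> y i)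
    \<and> (\<exists>v. \<forall>j\<in>V - (K \<union> f ` K). y j = v)"
  using assms
proof (induction V rule: finite_psubset_induct)
  case (psubset V)
  show ?case
  proof (cases "\<exists>v. \<forall>j\<in>V. y j = v")
    case True
    then show ?thesis by (intro exI[of _ "{}"]) auto
  next
    case False
    then obtain a b where ab: "a \<in> V" "b \<in> V" "y b \<noteq> y a" by metis
    obtain K f v where IH: "K \<subseteq> V - {a, b}" "f ` K \<subseteq> V - {a, b}" "inj_on f K" "f ` K \<inter> K = {}"
      "\<forall>i\<in>K. y (f i) \<noteq> y i" "\<forall>j\<in>V - {a, b} - (K \<union> f ` K). y j = v"
      using psubset.IH[of "V - {a, b}"] ab by blast
    have notin: "a \<notin> K" "b \<notin> K" "b \<notin> f ` K" "a \<notin> f ` K" "a \<noteq> b" using IH ab by auto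
    define g where "g = f(a := b)"
    have g: "g a = b" "\<And>i. i \<in> K \<Longrightarrow> g i = f i" using notin by (auto simp: g_def)
    then have img: "g ` insert a K = insert b (f ` K)" by auto
    have "inj_on g K" using IH(3) by (simp add: inj_on_def g)
    then have "inj_on g (insert a K)" using notin img g by (auto simp: inj_on_insert)
    moreover have "g ` insert a K \<inter> insert a K = {}" unfolding img using IH(4) notin by blast
    moreover have "\<forall>i\<in>insert a K. y (g i) \<noteq> y i" using IH(5) ab by (simp add: g)
    moreover have "\<forall>j\<in>V - (insert a K \<union> g ` insert a K). y j = v" unfolding img using IH(6) by blast
    moreover have "insert a K \<subseteq> V" "g ` insert a K \<subseteq> V" unfolding img using IH(1,2) ab by blast+
    ultimately show ?thesis by blast
  qed
qed

lemma card_sum_subset_eq_le: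
  fixes y :: "nat \<Rightarrow> int"
  assumes "2 \<le> d" "d + 2 \<le> n" "8 \<le> n" "0 < t" "0 < J"
    and t: "\<And>v. t \<le> real (card {j. j < n \<and> y j \<noteq> v})"
  defines "m \<equiv> t / 2 * split_prob n d"
  shows "real (card {R \<in> subsets_of_card n d. sum y R = a})
    \<le> real (n choose d) * (4 / m + 32 / real n + 1 / real J + 2 * real J / m)"
proof -
  obtain K f v where K: "K \<subseteq> {..<n}" "f ` K \<subseteq> {..<n}" "inj_on f K" "f ` K \<inter> K = {}"
      "\<forall>i\<in>K. y (f i) \<noteq> y i" "\<forall>j\<in>{..<n} - (K \<union> f ` K). y j = v"
    using maximal_matching[of "{..<n}" y] by auto
  interpret matching n K f
    using K by unfold_locales auto
  define m' where "m' = real (card K) * split_prob n d"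
  \<comment> \<open>Every coordinate that differs from the leftover value \<open>v\<close> lies in
    one of the pairs, two per pair; hence the \<open>t / 2\<close> in \<open>m\<close>.\<close>
  have "card {j. j < n \<and> y j \<noteq> v} \<le> card (K \<union> f ` K)"
    using K finite_K by (intro card_mono) auto
  also have "\<dots> = 2 * card K"
    using K finite_K by (subst card_Un_disjoint) (auto simp: card_image)
  finally have tK: "t \<le> 2 * real (card K)" using t[of v] by linarith
  then have ne: "K \<noteq> {}" using assms(4) by auto
  have q: "0 < split_prob n d" using assms by (intro split_prob_pos) auto
  then have m: "0 < m" "m \<le> m'"
    using tK assms(4) by (auto simp: m_def m'_def intro!: mult_right_mono)
  have "real (card {R \<in> subsets_of_card n d. sum y R = a})
      \<le> real (n choose d) * (4 / m' + 32 / real n + 1 / real J + 2 * real J / m')"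
    unfolding m'_def using K assms ne by (intro card_sum_eq_le) auto
  also have "\<dots> \<le> real (n choose d) * (4 / m + 32 / real n + 1 / real J + 2 * real J / m)"
    using m by (intro mult_left_mono add_mono divide_left_mono order_refl) auto
  finally show ?thesis .
qed

section \<open>Parities of sums of random rows\<close>

text \<open>The ratio of consecutive binomial probabilities crosses 1 at the mean, which here is the
  integer \<open>d\<close>.\<close>

lemma Bernstein_mode:
  assumes "0 < d" "d < n" "j \<le> n"
  shows "Bernstein n j (real d / real n) \<le> Bernstein n d (real d / real n)"
proof -
  define p where "p = real d / real n"
  have p: "0 < p" "p < 1" using assms by (auto simp: p_def)
  have q: "1 - p = (real n - real d) / real n" using assms by (simp add: p_def field_simps)
  have step: "real (Suc i) * (1 - p) * Bernstein n (Suc i) p = real (n - i) * p * Bernstein n i p" if "i < n" for i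
  proof -
    have "Suc i * (n choose Suc i) = (n - i) * (n choose i)"
      using binomial_absorption[of i n] binomial_absorb_comp[of n i] by simp
    then have coeff: "real (Suc i) * real (n choose Suc i) = real (n - i) * real (n choose i)"
      by (simp only: of_nat_mult[symmetric])
    have "n - i = Suc (n - Suc i)" using that by simp
    then have pow: "(1 - p) ^ (n - i) = (1 - p) * (1 - p) ^ (n - Suc i)" by (simp only: power_Suc)
    have "real (Suc i) * (1 - p) * Bernstein n (Suc i) p
        = (real (Suc i) * real (n choose Suc i)) * (p * p ^ i * ((1 - p) * (1 - p) ^ (n - Suc i)))"
      unfolding Bernstein_def power_Suc by (simp only: mult_ac)
    also have "\<dots> = real (n - i) * p * Bernstein n i p"
      unfolding coeff pow[symmetric] Bernstein_def by (simp only: mult_ac)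
    finally show ?thesis .
  qed
  have up: "Bernstein n i p \<le> Bernstein n (Suc i) p" if "i < d" for i
  proof -
    have "real (Suc i) * (1 - p) \<le> real (n - i) * p"
    proof -
      have "real (Suc i) * (real n - real d) \<le> (real n - real i) * real d"
      proof -
        have "real (Suc i) * real n \<le> real d * real n" using that by (intro mult_right_mono) auto
        then show ?thesis by (simp add: algebra_simps)
      qed
      moreover have "real (n - i) = real n - real i" using assms that by simp
      ultimately show ?thesis unfolding q unfolding p_def times_divide_eq_right by (simp only: divide_right_mono of_nat_0_le_iff)
    qed
    then have "real (Suc i) * (1 - p) * Bernstein n i p \<le> real (n - i) * p * Bernstein n i p"
      using p by (intro mult_right_mono) (auto simp: Bernstein_nonneg)
    also have "\<dots> = real (Suc i) * (1 - p) * Bernstein n (Suc i) p" using step that assms by simp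
    finally show ?thesis using p by (simp add: mult_le_cancel_left_pos)
  qed
  have down: "Bernstein n (Suc i) p \<le> Bernstein n i p" if "d \<le> i" "i < n" for i
  proof -
    have "real (n - i) * p \<le> real (Suc i) * (1 - p)"
    proof -
      have "(real n - real i) * real d \<le> real (Suc i) * (real n - real d)"
      proof -
        have "real d * real n \<le> real i * real n" "real d \<le> real n" using that assms by (auto intro!: mult_right_mono)
        then show ?thesis by (simp add: algebra_simps)
      qed
      moreover have "real (n - i) = real n - real i" using assms that by simp
      ultimately show ?thesis unfolding q unfolding p_def times_divide_eq_right by (simp only: divide_right_mono of_nat_0_le_iff)
    qed
    then have "real (n - i) * p * Bernstein n i p \<le> real (Suc i) * (1 - p) * Bernstein n i p"
      using p by (intro mult_right_mono) (auto simp: Bernstein_nonneg)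
    then have "real (Suc i) * (1 - p) * Bernstein n (Suc i) p \<le> real (Suc i) * (1 - p) * Bernstein n i p"
      using step that by simp
    then show ?thesis using p by (simp add: mult_le_cancel_left_pos)
  qed
  show ?thesis
    unfolding p_def[symmetric]
  proof (cases "j \<le> d")
    case True
    then show "Bernstein n j p \<le> Bernstein n d p"
    proof (induction rule: inc_induct)
      case (step i)
      then show ?case using up[of i] by simp
    qed simp
  next
    case False
    then have "d \<le> j" by simp
    then show "Bernstein n j p \<le> Bernstein n d p"
      using assms(3)
    proof (induction rule: dec_induct)
      case (step i)
      then show ?case using down[of i] by simp
    qed simp
  qed
qed

text \<open>By Markov's inequality at least half of the mass lies on \<open>j \<le> 2 * d\<close>,
  that is, on at most \<open>2 * d + 1\<close> values, none of them more likely than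
  \<open>d\<close>.\<close>

lemma Bernstein_mean_ge:
  assumes "0 < d" "d < n"
  shows "1 \<le> 2 * (2 * real d + 1) * Bernstein n d (real d / real n)"
proof -
  define p where "p = real d / real n"
  define B where "B j = Bernstein n j p" for j
  have p: "0 < p" "p < 1" using assms by (auto simp: p_def)
  have B: "0 \<le> B j" for j using p by (simp add: B_def Bernstein_nonneg)
  have "1 = (\<Sum>j\<le>n. B j)" by (simp add: B_def)
  also have "\<dots> \<le> (\<Sum>j\<le>n. of_bool (j \<le> 2 * d) * B d + real j * B j / (2 * real d))"
  proof (rule sum_mono)
    fix j assume j: "j \<in> {..n}"
    show "B j \<le> of_bool (j \<le> 2 * d) * B d + real j * B j / (2 * real d)"
    proof (cases "j \<le> 2 * d")
      case True
      then show ?thesis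
        using Bernstein_mode[OF assms, of j] j B[of j] by (simp add: B_def p_def add_increasing2)
    next
      case False
      then have "2 * real d * B j \<le> real j * B j" by (intro mult_right_mono B) auto
      then show ?thesis using False assms by (simp add: field_simps)
    qed
  qed
  also have "\<dots> = (\<Sum>j\<le>n. of_bool (j \<le> 2 * d)) * B d + (\<Sum>j\<le>n. real j * B j) / (2 * real d)"
    by (simp only: sum.distrib sum_distrib_right sum_divide_distrib)
  also have "(\<Sum>j\<le>n. real j * B j) = real d"
    using assms by (simp add: B_def p_def)
  also have "(\<Sum>j\<le>n. of_bool (j \<le> 2 * d)) \<le> real (card {..2 * d})"
  proof -
    have "card ({..n} \<inter> {j. j \<le> 2 * d}) \<le> card {..2 * d}" by (intro card_mono) auto
    then have "real (card ({..n} \<inter> {j. j \<le> 2 * d})) \<le> real (card {..2 * d})" by (simp only: of_nat_le_iff)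
    then show ?thesis by (simp del: card_atMost)
  qed
  finally have "1 \<le> real (card {..2 * d}) * B d + real d / (2 * real d)"
    using B[of d] by (simp add: mult_right_mono)
  then show ?thesis using assms by (simp add: B_def p_def algebra_simps)
qed

text \<open>Variance of a binomial variable with parameters \<open>n\<close> and
  \<open>d / n\<close>. For \<open>d \<le> n\<close> it is invariant under exchanging
  \<open>d\<close> and \<open>n - d\<close>, so sparse and dense rows are treated alike, and it lies
  between half of \<open>min d (n - d)\<close> and that minimum.\<close>

definition row_variance :: "nat \<Rightarrow> nat \<Rightarrow> real" where
  "row_variance n d = real d * real (n - d) / real n"

text \<open>The price of conditioning a Bernoulli row on having \<open>d\<close> ones. It is cruder
  than the local limit theorem, but only exponentials in the variance matter. By symmetry
  \<open>2 * d \<le> n\<close> may be assumed, and then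
  \<open>2 * (2 * d + 1) \<le> 6 * d \<le> 12 * row_variance n d\<close>.\<close>

lemma Bernstein_row_variance:
  assumes "0 < d" "d < n"
  shows "1 \<le> 12 * row_variance n d * Bernstein n d (real d / real n)"
proof -
  have *: "1 \<le> 12 * row_variance n d * Bernstein n d (real d / real n)" if d: "0 < d" "2 * d \<le> n" for d
  proof -
    have "2 * (2 * real d + 1) \<le> 6 * real d" using d by simp
    also have "\<dots> = 12 * (real d * (real n / 2) / real n)" using d by simp
    also have "\<dots> \<le> 12 * row_variance n d"
      unfolding row_variance_def using d by (intro mult_left_mono divide_right_mono) auto
    finally have "2 * (2 * real d + 1) * Bernstein n d (real d / real n) \<le> 12 * row_variance n d * Bernstein n d (real d / real n)"
      using d by (intro mult_right_mono) (auto intro!: Bernstein_nonneg)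
    moreover have "1 \<le> 2 * (2 * real d + 1) * Bernstein n d (real d / real n)"
      using d by (intro Bernstein_mean_ge) auto
    ultimately show ?thesis by linarith
  qed
  show ?thesis
  proof (cases "2 * d \<le> n")
    case True
    then show ?thesis using * assms by blast
  next
    case False
    have "row_variance n (n - d) = row_variance n d" using assms by (simp add: row_variance_def mult.commute)
    moreover have "real (n - d) / real n = 1 - real d / real n" using assms by (simp add: field_simps)
    then have "Bernstein n (n - d) (real (n - d) / real n) = Bernstein n d (real d / real n)"
      using assms by (simp add: Bernstein_def binomial_symmetric[of d n] mult_ac)
    ultimately show ?thesis using *[of "n - d"] False assms by simp
  qed
qed

section \<open>Comparison with independent Bernoulli entries\<close>

abbreviation row_pmf :: "nat \<Rightarrow> nat \<Rightarrow> nat set pmf" where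
  "row_pmf n d \<equiv> pmf_of_set (subsets_of_card n d)"

text \<open>Sum of the rows in \<open>A\<close> modulo 2, with target vector given by its support
  \<open>v\<close>. In the end \<open>v = {}\<close>; general targets are for the induction on rows,
  where an added row \<open>X\<close> replaces \<open>v\<close> by its symmetric difference with
  \<open>X\<close>.\<close>

definition parity_event :: "nat \<Rightarrow> nat set \<Rightarrow> nat set \<Rightarrow> (nat \<Rightarrow> nat set) set" where
  "parity_event n A v = {R. \<forall>j<n. odd (card {i \<in> A. j \<in> R i}) = (j \<in> v)}"

definition parity_prob :: "nat \<Rightarrow> nat \<Rightarrow> nat set \<Rightarrow> nat set \<Rightarrow> real" where
  "parity_prob n d A v = measure_pmf.prob (Pi_pmf A {} (\<lambda>_. row_pmf n d)) (parity_event n A v)"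

lemma measure_bind_pmf:
  "measure_pmf.prob (M \<bind> f) X = (\<integral>x. measure_pmf.prob (f x) X \<partial>measure_pmf M)"
proof -
  have "integrable (measure_pmf M) (\<lambda>x. measure_pmf.prob (f x) X)"
    by (rule measure_pmf.integrable_const_bound[of _ 1]) auto
  then have "ennreal (measure_pmf.prob (M \<bind> f) X) = ennreal (\<integral>x. measure_pmf.prob (f x) X \<partial>measure_pmf M)"
    by (simp only: nn_integral_eq_integral[symmetric] measure_pmf.emeasure_eq_measure[symmetric] emeasure_bind_pmf measure_nonneg AE_I2)
  then show ?thesis by (simp add: integral_nonneg)
qed

lemma parity_prob_insert:
  assumes "finite A" "x \<notin> A" "d \<le> n"
  shows "parity_prob n d (insert x A) v
    = (\<Sum>X\<in>subsets_of_card n d. parity_prob n d A {j. (j \<in> v) \<noteq> (j \<in> X)}) / real (n choose d)"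
proof -
  let ?S = "subsets_of_card n d" and ?P = "Pi_pmf A {} (\<lambda>_. row_pmf n d)"
  have flip: "odd (card {i \<in> insert x A. j \<in> (R(x := X)) i}) = (odd (card {i \<in> A. j \<in> R i}) \<noteq> (j \<in> X))" for j R X
  proof -
    have "{i \<in> insert x A. j \<in> (R(x := X)) i} = (if j \<in> X then insert x {i \<in> A. j \<in> R i} else {i \<in> A. j \<in> R i})"
      using assms(2) by auto
    then show ?thesis using assms by auto
  qed
  have vimage: "(\<lambda>R. R(x := X)) -` parity_event n (insert x A) v = parity_event n A {j. (j \<in> v) \<noteq> (j \<in> X)}" for X
    unfolding parity_event_def vimage_def mem_Collect_eq flip by blast
  have "parity_prob n d (insert x A) v
      = measure_pmf.prob (row_pmf n d \<bind> (\<lambda>X. map_pmf (\<lambda>R. R(x := X)) ?P)) (parity_event n (insert x A) v)"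
    unfolding parity_prob_def Pi_pmf_insert'[OF assms(1,2)] by (simp add: map_pmf_def)
  also have "\<dots> = (\<integral>X. measure_pmf.prob (map_pmf (\<lambda>R. R(x := X)) ?P) (parity_event n (insert x A) v) \<partial>row_pmf n d)"
    by (rule measure_bind_pmf)
  also have "\<dots> = (\<integral>X. parity_prob n d A {j. (j \<in> v) \<noteq> (j \<in> X)} \<partial>row_pmf n d)"
    by (simp only: measure_map_pmf vimage parity_prob_def)
  also have "\<dots> = (\<Sum>X\<in>?S. parity_prob n d A {j. (j \<in> v) \<noteq> (j \<in> X)}) / real (n choose d)"
    using subsets_of_card_nonempty[OF assms(3)] by (simp add: integral_pmf_of_set card_subsets_of_card)
  finally show ?thesis .
qed

text \<open>A further independent row only averages over shifted targets, so a bound uniform in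
  \<open>v\<close> survives. This allows estimates that use fewer rows than \<open>A\<close>
  has.\<close>

lemma parity_prob_mono:
  assumes "finite A" "A' \<subseteq> A" "d \<le> n" and bound: "\<And>v. parity_prob n d A' v \<le> \<beta>"
  shows "parity_prob n d A v \<le> \<beta>"
proof -
  have "parity_prob n d (A' \<union> B) v \<le> \<beta>" if "finite B" "B \<inter> A' = {}" for B v
    using that
  proof (induction B arbitrary: v rule: finite_induct)
    case empty
    then show ?case using bound by simp
  next
    case (insert x B)
    have fin: "finite A'" using assms finite_subset by blast
    have "(\<Sum>X\<in>subsets_of_card n d. parity_prob n d (A' \<union> B) {j. (j \<in> v) \<noteq> (j \<in> X)}) \<le> (\<Sum>X\<in>subsets_of_card n d. \<beta>)"
      using insert by (intro sum_mono insert.IH) auto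
    then have "parity_prob n d (insert x (A' \<union> B)) v \<le> (\<Sum>X\<in>subsets_of_card n d. \<beta>) / real (n choose d)"
      using insert.hyps insert.prems fin assms(3) by (subst parity_prob_insert) (auto intro!: divide_right_mono)
    also have "\<dots> = \<beta>" using assms(3) by (simp add: card_subsets_of_card)
    finally show ?case by simp
  qed
  from this[of "A - A'" v] show ?thesis
    using assms by (simp add: Un_absorb1 Un_Diff_cancel Diff_Int_distrib2 Int_commute Int_Diff)
qed

text \<open>Probability that a binomial variable with parameters \<open>k\<close> and
  \<open>p\<close> is odd, if \<open>b\<close> holds, or even otherwise.\<close>

definition parity_weight :: "real \<Rightarrow> nat \<Rightarrow> bool \<Rightarrow> real" where
  "parity_weight p k b = (if b then (1 - (1 - 2 * p) ^ k) / 2 else (1 + (1 - 2 * p) ^ k) / 2)"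

lemma parity_weight_Suc:
  "parity_weight p (Suc k) b = p * parity_weight p k (\<not> b) + (1 - p) * parity_weight p k b"
  by (simp add: parity_weight_def field_simps)

lemma parity_weight_nonneg:
  assumes "0 \<le> p" "p \<le> 1"
  shows "0 \<le> parity_weight p k b"
proof -
  have "\<bar>(1 - 2 * p) ^ k\<bar> \<le> 1" unfolding power_abs using assms by (intro power_le_one) auto
  then show ?thesis by (auto simp: parity_weight_def)
qed

text \<open>Each of the independent uniform \<open>d\<close>-subsets is a Bernoulli random subset with parameter \<open>d / n\<close>
  conditioned on an event of probability \<open>Bernstein n d (d / n)\<close>. For the Bernoulli model the columns
  are independent.\<close>

lemma parity_prob_Bernoulli:
  assumes "finite A" "d \<le> n"
  defines "p \<equiv> real d / real n"
  shows "parity_prob n d A v * Bernstein n d p ^ card A \<le> (\<Prod>j<n. parity_weight p (card A) (j \<in> v))"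
  using assms(1)
proof (induction A arbitrary: v rule: finite_induct)
  case empty
  show ?case
  proof (cases "\<exists>j<n. j \<in> v")
    case True
    then have "parity_prob n d {} v = 0" by (auto simp: parity_prob_def parity_event_def)
    then show ?thesis by (auto intro!: prod_nonneg simp: parity_weight_def)
  next
    case False
    then have "(\<Prod>j<n. parity_weight p 0 (j \<in> v)) = 1" by (intro prod.neutral) (auto simp: parity_weight_def)
    then show ?thesis by (simp add: parity_prob_def)
  qed
next
  case (insert x A)
  let ?S = "subsets_of_card n d" and ?B = "Bernstein n d p" and ?k = "card A"
  \<comment> \<open>Probability, for independent entries, that the new row is \<open>X\<close> and
    that the old rows have the column parities which \<open>X\<close> then requires.\<close>
  define g where "g X = (\<Prod>j\<in>X. p * parity_weight p ?k (j \<notin> v)) * (\<Prod>j\<in>{..<n} - X. (1 - p) * parity_weight p ?k (j \<in> v))" for X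
  have p: "0 \<le> p" "p \<le> 1" using assms(2) by (auto simp: p_def divide_simps)
  have N: "real (n choose d) > 0" using assms(2) by simp
  have g: "?B / real (n choose d) * (\<Prod>j<n. parity_weight p ?k ((j \<in> v) \<noteq> (j \<in> X))) = g X" if "X \<in> ?S" for X
  proof -
    have X: "X \<subseteq> {..<n}" "card X = d" using that by (auto simp: subsets_of_card_def)
    then have "finite X" using finite_subset by blast
    then have c: "card ({..<n} - X) = n - d" using X by (simp add: card_Diff_subset)
    have "(\<Prod>j<n. parity_weight p ?k ((j \<in> v) \<noteq> (j \<in> X)))
        = (\<Prod>j\<in>{..<n} - X. parity_weight p ?k ((j \<in> v) \<noteq> (j \<in> X))) * (\<Prod>j\<in>X. parity_weight p ?k ((j \<in> v) \<noteq> (j \<in> X)))"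
      using X by (intro prod.subset_diff) auto
    then show ?thesis
      using N by (simp add: g_def prod.distrib c X(2) Bernstein_def)
  qed
  have "parity_prob n d (insert x A) v * ?B ^ card (insert x A)
      = ?B / real (n choose d) * (\<Sum>X\<in>?S. parity_prob n d A {j. (j \<in> v) \<noteq> (j \<in> X)} * ?B ^ ?k)"
    using insert.hyps assms(2) by (simp add: parity_prob_insert mult_ac flip: sum_distrib_left)
  also have "\<dots> \<le> ?B / real (n choose d) * (\<Sum>X\<in>?S. \<Prod>j<n. parity_weight p ?k (j \<in> {j. (j \<in> v) \<noteq> (j \<in> X)}))"
    using p by (intro mult_left_mono sum_mono insert.IH) (auto intro!: Bernstein_nonneg divide_nonneg_nonneg)
  also have "\<dots> = (\<Sum>X\<in>?S. g X)"
    unfolding sum_distrib_left by (intro sum.cong refl) (simp only: mem_Collect_eq g)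
  \<comment> \<open>Admitting rows with any number of ones makes the sum factor over the
    columns.\<close>
  also have "\<dots> \<le> (\<Sum>X\<in>Pow {..<n}. g X)"
    using p by (intro sum_mono2) (auto simp: subsets_of_card_def g_def intro!: mult_nonneg_nonneg prod_nonneg parity_weight_nonneg)
  also have "\<dots> = (\<Prod>j<n. p * parity_weight p ?k (j \<notin> v) + (1 - p) * parity_weight p ?k (j \<in> v))"
    unfolding g_def by (subst prod_add) auto
  also have "\<dots> = (\<Prod>j<n. parity_weight p (card (insert x A)) (j \<in> v))"
    using insert.hyps by (simp add: parity_weight_Suc)
  finally show ?case .
qed

text \<open>The exponent has the constant 1 for small k l, as the threshold requires, and stays
  bounded for large k l, where the weight is near 1 / 2. The chain is |1 - 2 p| <= 1 - 2 l <= exp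
  (-2 l), followed by exp (-x) <= 1 / (1 + x).\<close>

lemma parity_weight_le_exp:
  assumes "0 \<le> p" "p \<le> 1"
  defines "l \<equiv> p * (1 - p)"
  shows "parity_weight p k b \<le> exp (- (real k * l / (1 + 2 * real k * l)))"
proof -
  have l: "0 \<le> l" using assms by (simp add: l_def)
  have sq: "0 \<le> p * p" "0 \<le> (1 - p) * (1 - p)" by simp_all
  have "\<bar>1 - 2 * p\<bar> \<le> 1 - 2 * l" using sq unfolding l_def by (intro abs_leI) (simp_all add: algebra_simps)
  also have "\<dots> \<le> exp (- (2 * l))" using exp_ge_add_one_self[of "- (2 * l)"] by simp
  finally have "\<bar>1 - 2 * p\<bar> ^ k \<le> exp (- (2 * l)) ^ k" by (intro power_mono) auto
  also have "\<dots> = inverse (exp (2 * real k * l))"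
    unfolding exp_of_nat_mult[symmetric] exp_minus[symmetric] by (rule arg_cong[where f = exp]) (simp only: mult_ac mult_minus_right)
  also have "\<dots> \<le> inverse (1 + 2 * real k * l)"
    using l exp_ge_add_one_self[of "2 * real k * l"] by (intro le_imp_inverse_le) (auto intro!: add_pos_nonneg)
  finally have *: "\<bar>(1 - 2 * p) ^ k\<bar> \<le> inverse (1 + 2 * real k * l)" unfolding power_abs .
  have "parity_weight p k b \<le> (1 + inverse (1 + 2 * real k * l)) / 2"
  proof -
    have "(if b then (1 - a) / 2 else (1 + a) / 2) \<le> (1 + I) / 2" if "\<bar>a\<bar> \<le> I" for a I :: real
      using abs_le_D1[OF that] abs_le_D2[OF that] by simp
    from this[OF *] show ?thesis unfolding parity_weight_def .
  qed
  also have "\<dots> = 1 - real k * l / (1 + 2 * real k * l)"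
  proof -
    have "1 + 2 * real k * l > 0" using l by (intro add_pos_nonneg) auto
    then show ?thesis by (simp add: field_simps)
  qed
  also have "\<dots> \<le> exp (- (real k * l / (1 + 2 * real k * l)))"
    using exp_ge_add_one_self[of "- (real k * l / (1 + 2 * real k * l))"] by simp
  finally show ?thesis .
qed

text \<open>Common bound for both events on sparse sets. The power of \<open>12 * L\<close> is the
  price of conditioning in \<open>parity_prob_le_decay\<close>; the constant 8 comes from
  \<open>prob_rows_constant_parity_le\<close>. The denominator caps the exponent at n / 8.\<close>

definition decay :: "real \<Rightarrow> nat \<Rightarrow> nat \<Rightarrow> real" where
  "decay L n k = (12 * L) ^ k * exp (- (real k * L / (1 + 8 * real k * L / real n)))"

lemma parity_prob_le_decay:
  assumes "finite A" "0 < d" "d < n" "1 \<le> k" "k \<le> card A"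
  shows "parity_prob n d A v \<le> decay (row_variance n d) n k"
proof -
  define L p where "L = row_variance n d" and "p = real d / real n"
  let ?B = "Bernstein n d p"
  have p: "0 < p" "p < 1" using assms by (auto simp: p_def)
  have B: "0 < ?B" using p assms by (intro Bernstein_pos) auto
  have L: "0 < L" "real n * (p * (1 - p)) = L"
    using assms by (auto simp: L_def row_variance_def p_def field_simps)
  \<comment> \<open>Only \<open>k\<close> rows pay the factor \<open>12 * L\<close>; the remaining
    ones are averaged out.\<close>
  obtain A' where A': "A' \<subseteq> A" "card A' = k" using obtain_subset_with_card_n[OF assms(5)] by blast
  have finA': "finite A'" using A' assms(1) finite_subset by blast
  have "parity_prob n d A' u \<le> decay L n k" for u
  proof -
    define e where "e = real k * (p * (1 - p)) / (1 + 2 * real k * (p * (1 - p)))"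
    have "parity_prob n d A' u = (parity_prob n d A' u * ?B ^ k) * (1 / ?B) ^ k"
      using B by (simp add: power_one_over field_simps)
    also have "\<dots> \<le> exp (- (real n * e)) * (12 * L) ^ k"
    proof (rule mult_mono)
      have "parity_prob n d A' u * ?B ^ k \<le> (\<Prod>j<n. parity_weight p k (j \<in> u))"
        using parity_prob_Bernoulli[OF finA', of d n u] assms A' by (simp add: p_def)
      also have "\<dots> \<le> (\<Prod>j<n. exp (- e))"
        using p unfolding e_def by (intro prod_mono conjI parity_weight_le_exp parity_weight_nonneg) auto
      also have "\<dots> = exp (- (real n * e))" by (simp flip: exp_of_nat_mult)
      finally show "parity_prob n d A' u * ?B ^ k \<le> exp (- (real n * e))" .
      have "1 / ?B \<le> 12 * L"
        using Bernstein_row_variance[OF assms(2,3)] B by (simp add: L_def p_def field_simps)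
      then show "(1 / ?B) ^ k \<le> (12 * L) ^ k" using B by (intro power_mono) auto
    qed (use B in auto)
    also have "\<dots> \<le> exp (- (real k * L / (1 + 8 * real k * L / real n))) * (12 * L) ^ k"
    proof -
      have "real k * L / (1 + 8 * real k * L / real n) \<le> real k * L / (1 + 2 * real k * L / real n)"
        using L by (intro divide_left_mono add_left_mono divide_right_mono mult_pos_pos add_pos_nonneg) auto
      also have "\<dots> = real n * e"
        unfolding e_def L(2)[symmetric] using assms by (simp add: mult_ac)
      finally show ?thesis using L by (intro mult_right_mono) auto
    qed
    finally show ?thesis by (simp add: decay_def mult.commute)
  qed
  then show ?thesis
    unfolding L_def using assms A' by (intro parity_prob_mono[of A A']) auto
qed

section \<open>Kernel vectors of zero-one matrices\<close>

text \<open>Halving all entries while they are even must end, since the absolute value of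
  \<open>x a\<close> decreases. The resulting \<open>x'\<close> satisfies the same homogeneous
  equations as \<open>x\<close> and is nonzero modulo 2.\<close>

lemma odd_multiple:
  fixes x :: "'a \<Rightarrow> int"
  assumes "\<exists>a\<in>A. x a \<noteq> 0"
  obtains g x' where "g \<noteq> 0" "\<forall>j\<in>A. x j = g * x' j" "\<exists>j\<in>A. odd (x' j)"
proof -
  obtain a where a: "a \<in> A" "x a \<noteq> 0" using assms by blast
  have "\<exists>g x'. g \<noteq> 0 \<and> (\<forall>j\<in>A. x j = g * x' j) \<and> (\<exists>j\<in>A. odd (x' j))"
    using a(2)
  proof (induction "nat \<bar>x a\<bar>" arbitrary: x rule: less_induct)
    case less
    show ?case
    proof (cases "\<exists>j\<in>A. odd (x j)")
      case True
      then show ?thesis by (intro exI[of _ 1] exI[of _ x]) auto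
    next
      case False
      then have ev: "\<And>j. j \<in> A \<Longrightarrow> x j = 2 * (x j div 2)" by auto
      then have "x a div 2 \<noteq> 0" "nat \<bar>x a div 2\<bar> < nat \<bar>x a\<bar>"
        using ev[OF a(1)] less.prems by linarith+
      then obtain g x' where g: "g \<noteq> 0" "\<forall>j\<in>A. x j div 2 = g * x' j" "\<exists>j\<in>A. odd (x' j)"
        using less.hyps[of "\<lambda>j. x j div 2"] by auto
      moreover have "x j = 2 * g * x' j" if "j \<in> A" for j using ev[OF that] g(2) that by simp
      ultimately show ?thesis by (intro exI[of _ "2 * g"] exI[of _ x']) auto
    qed
  qed
  then show ?thesis using that by blast
qed

text \<open>The determinant criterion for kernel vectors is applied over the integral domain of
  integers, so no denominators have to be cleared.\<close>

lemma int_kernel_vector: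
  fixes a :: "nat \<Rightarrow> nat \<Rightarrow> int"
  assumes "det (mat n n (\<lambda>(i, j). a i j)) = 0"
  shows "\<exists>x. (\<exists>j<n. x j \<noteq> 0) \<and> (\<forall>i<n. (\<Sum>j<n. a i j * x j) = 0)"
proof -
  let ?A = "mat n n (\<lambda>(i, j). a i j)"
  obtain v where v: "v \<in> carrier_vec n" "v \<noteq> 0\<^sub>v n" "?A *\<^sub>v v = 0\<^sub>v n"
    using assms det_0_iff_vec_prod_zero[of ?A n] by auto
  have "\<exists>j<n. v $ j \<noteq> 0"
    using v(1,2) by (auto intro!: eq_vecI)
  moreover have "(\<Sum>j<n. a i j * v $ j) = 0" if "i < n" for i
  proof -
    have "(?A *\<^sub>v v) $ i = (\<Sum>j<n. a i j * v $ j)"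
      using that v(1) by (auto simp: scalar_prod_def atLeast0LessThan intro!: sum.cong)
    then show ?thesis using that v(3) by simp
  qed
  ultimately show ?thesis by (intro exI[of _ "\<lambda>j. v $ j"]) auto
qed

definition incidence_mat :: "nat \<Rightarrow> (nat \<Rightarrow> nat set) \<Rightarrow> real mat" where
  "incidence_mat n R = mat n n (\<lambda>(i, j). of_bool (j \<in> R i))"

lemma singular_left_kernel:
  assumes "\<not> invertible_mat (incidence_mat n R)"
  shows "\<exists>x :: nat \<Rightarrow> int. (\<exists>i<n. x i \<noteq> 0) \<and> (\<forall>j<n. (\<Sum>l | l < n \<and> j \<in> R l. x l) = 0)"
proof -
  define M :: "int mat" where "M = mat n n (\<lambda>(i, j). of_bool (j \<in> R i))"
  have M: "M \<in> carrier_mat n n" by (simp add: M_def)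
  have Q: "incidence_mat n R = map_mat of_int M"
    by (rule eq_matI) (auto simp: incidence_mat_def M_def)
  have "det (incidence_mat n R) = 0"
  proof (rule ccontr)
    assume "det (incidence_mat n R) \<noteq> 0"
    then have "incidence_mat n R \<in> Units (ring_mat TYPE(real) n ())"
      using det_non_zero_imp_unit[of "incidence_mat n R" n] by (simp add: incidence_mat_def)
    then have "invertible_mat (incidence_mat n R)"
      by (auto simp: Units_def ring_mat_def invertible_mat_def inverts_mat_def incidence_mat_def)
    then show False using assms by simp
  qed
  then have "det M = 0" unfolding Q by simp
  then have "det (transpose_mat M) = 0" using det_transpose[OF M] by simp
  moreover have "transpose_mat M = mat n n (\<lambda>(i, j). of_bool (i \<in> R j))"
    by (rule eq_matI) (auto simp: M_def)
  ultimately obtain x :: "nat \<Rightarrow> int" where x: "\<exists>j<n. x j \<noteq> 0" "\<forall>i<n. (\<Sum>j<n. of_bool (i \<in> R j) * x j) = 0"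
    using int_kernel_vector[of n "\<lambda>i j. of_bool (i \<in> R j)"] by auto
  have "(\<Sum>l | l < n \<and> j \<in> R l. x l) = (\<Sum>l<n. of_bool (j \<in> R l) * x l)" for j
    by (rule sum.mono_neutral_cong_left) auto
  then show ?thesis using x by auto
qed

text \<open>Replacing row \<open>i\<close> by zero makes the matrix singular. Thus \<open>y\<close>
  can be fixed before row \<open>i\<close> is drawn.\<close>

lemma right_kernel_of_other_rows:
  assumes "i < n" "\<And>l. l < n \<Longrightarrow> R l \<subseteq> {..<n}"
  shows "\<exists>y :: nat \<Rightarrow> int. (\<exists>j<n. y j \<noteq> 0) \<and> (\<forall>l<n. l \<noteq> i \<longrightarrow> sum y (R l) = 0)"
proof -
  define a :: "nat \<Rightarrow> nat \<Rightarrow> int" where "a l j = (if l = i then 0 else of_bool (j \<in> R l))" for l j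
  let ?A = "mat n n (\<lambda>(i, j). a i j)"
  have "transpose_mat ?A *\<^sub>v unit_vec n i = 0\<^sub>v n"
    using assms(1) by (intro eq_vecI) (auto simp: a_def)
  then have "det (transpose_mat ?A) = 0"
    using assms(1) by (subst det_0_iff_vec_prod_zero[of _ n]) (auto intro!: exI[of _ "unit_vec n i"])
  then have "det ?A = 0" using det_transpose[of ?A n] by simp
  then obtain y where y: "\<exists>j<n. y j \<noteq> 0" "\<forall>l<n. (\<Sum>j<n. a l j * y j) = 0"
    using int_kernel_vector by blast
  have "sum y (R l) = (\<Sum>j<n. a l j * y j)" if "l < n" "l \<noteq> i" for l
    using assms(2)[OF that(1)] that by (intro sum.mono_neutral_cong_left) (auto simp: a_def)
  then show ?thesis using y by auto
qed

text \<open>A nonzero coefficient \<open>x i\<close> in a left kernel vector: row \<open>i\<close> lies in the span of the other rows.\<close>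

definition dependent_row :: "nat \<Rightarrow> (nat \<Rightarrow> nat set) \<Rightarrow> nat \<Rightarrow> bool" where
  "dependent_row n R i \<longleftrightarrow> (\<exists>x :: nat \<Rightarrow> int. x i \<noteq> 0 \<and> (\<forall>j<n. (\<Sum>l | l < n \<and> j \<in> R l. x l) = 0))"

text \<open>The bilinear form of \<open>x\<close> and \<open>y\<close> vanishes when summed by
  columns; summed by rows, only \<open>x i * sum y (R i)\<close> is left.\<close>

lemma dependent_row_kernel:
  fixes y :: "nat \<Rightarrow> int"
  assumes "dependent_row n R i" "i < n" and R: "\<And>l. l < n \<Longrightarrow> R l \<subseteq> {..<n}"
    and y: "\<And>l. l < n \<Longrightarrow> l \<noteq> i \<Longrightarrow> sum y (R l) = 0"
  shows "sum y (R i) = 0"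
proof -
  obtain x :: "nat \<Rightarrow> int" where x: "x i \<noteq> 0" "\<And>j. j < n \<Longrightarrow> (\<Sum>l | l < n \<and> j \<in> R l. x l) = 0"
    using assms(1) unfolding dependent_row_def by auto
  have rows: "sum y (R l) = (\<Sum>j<n. of_bool (j \<in> R l) * y j)" if "l < n" for l
    using R[OF that] by (intro sum.mono_neutral_cong_left) auto
  have cols: "(\<Sum>l<n. of_bool (j \<in> R l) * x l) = 0" if "j < n" for j
  proof -
    have "(\<Sum>l | l < n \<and> j \<in> R l. x l) = (\<Sum>l<n. of_bool (j \<in> R l) * x l)"
      by (rule sum.mono_neutral_cong_left) auto
    then show ?thesis using x(2)[OF that] by simp
  qed
  have "x i * sum y (R i) = (\<Sum>l\<in>{i}. x l * sum y (R l))" by simp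
  also have "\<dots> = (\<Sum>l<n. x l * sum y (R l))"
    using assms(2) y by (intro sum.mono_neutral_left) auto
  also have "\<dots> = (\<Sum>l<n. \<Sum>j<n. y j * (of_bool (j \<in> R l) * x l))"
    by (intro sum.cong refl) (simp only: rows lessThan_iff sum_distrib_left mult_ac)
  also have "\<dots> = (\<Sum>j<n. \<Sum>l<n. y j * (of_bool (j \<in> R l) * x l))"
    by (rule sum.swap)
  also have "\<dots> = 0"
    unfolding sum_distrib_left[symmetric] by (intro sum.neutral ballI) (simp only: cols lessThan_iff mult_zero_right)
  finally show ?thesis using x(1) by simp
qed

lemma singular_cases:
  fixes t :: real
  assumes "\<not> invertible_mat (incidence_mat n R)"
  shows "t \<le> real (card {i. i < n \<and> dependent_row n R i})
    \<or> (\<exists>S. S \<subseteq> {..<n} \<and> S \<noteq> {} \<and> real (card S) < t \<and> R \<in> parity_event n S {})"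
proof (rule disj_imp[THEN iffD2], rule impI)
  assume small: "\<not> t \<le> real (card {i. i < n \<and> dependent_row n R i})"
  obtain x where x: "\<exists>i<n. x i \<noteq> (0 :: int)" "\<And>j. j < n \<Longrightarrow> (\<Sum>l | l < n \<and> j \<in> R l. x l) = 0"
    using singular_left_kernel[OF assms] by auto
  then have "\<exists>i\<in>{..<n}. x i \<noteq> 0" by auto
  then obtain g x' where gx: "g \<noteq> 0" "\<forall>l\<in>{..<n}. x l = g * x' l" and odd: "\<exists>l\<in>{..<n}. odd (x' l)"
    by (rule odd_multiple)
  have x': "(\<Sum>l | l < n \<and> j \<in> R l. x' l) = 0" if "j < n" for j
  proof -
    have "g * (\<Sum>l | l < n \<and> j \<in> R l. x' l) = (\<Sum>l | l < n \<and> j \<in> R l. x l)"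
      by (simp add: sum_distrib_left gx(2))
    then show ?thesis using x(2)[OF that] gx(1) by simp
  qed
  define S where "S = {l. l < n \<and> odd (x' l)}"
  \<comment> \<open>The single vector \<open>x'\<close> witnesses the dependence of every row at
    which it is odd, so a large \<open>S\<close> leads to the first case.\<close>
  have "S \<subseteq> {i. i < n \<and> dependent_row n R i}"
    using x' by (auto simp: S_def dependent_row_def intro!: exI[of _ x'])
  then have "card S \<le> card {i. i < n \<and> dependent_row n R i}" by (intro card_mono) auto
  moreover have "even (card {l \<in> S. j \<in> R l})" if "j < n" for j
  proof -
    have "even (card {l \<in> {l. l < n \<and> j \<in> R l}. odd (x' l)})"
      using x'[OF that] even_sum_iff[of "{l. l < n \<and> j \<in> R l}" x'] by simp
    moreover have "{l \<in> {l. l < n \<and> j \<in> R l}. odd (x' l)} = {l \<in> S. j \<in> R l}" by (auto simp: S_def)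
    ultimately show ?thesis by simp
  qed
  ultimately show "\<exists>S. S \<subseteq> {..<n} \<and> S \<noteq> {} \<and> real (card S) < t \<and> R \<in> parity_event n S {}"
    using small odd by (intro exI[of _ S]) (auto simp: S_def parity_event_def)
qed

text \<open>Subtracting the dominant value \<open>v\<close> from \<open>y\<close> leaves a sparse vector whose products with all rows
  other than \<open>i\<close> coincide, since all rows have the same sum. It is then reduced modulo 2.\<close>

lemma sparse_kernel_parity:
  fixes y :: "nat \<Rightarrow> int" and t :: real
  assumes "2 \<le> n" "0 < d" and R: "\<And>l. l < n \<Longrightarrow> R l \<in> subsets_of_card n d"
    and y: "\<exists>j<n. y j \<noteq> 0" "\<And>l. l < n \<Longrightarrow> l \<noteq> i \<Longrightarrow> sum y (R l) = 0"
    and v: "real (card {j. j < n \<and> y j \<noteq> v}) < t"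
  shows "\<exists>T. T \<subseteq> {..<n} \<and> T \<noteq> {} \<and> real (card T) < t \<and> (\<exists>b. \<forall>l<n. l \<noteq> i \<longrightarrow> even (card (R l \<inter> T)) = b)"
proof -
  define z where "z j = y j - v" for j
  have R': "R l \<subseteq> {..<n}" "finite (R l)" "card (R l) = d" if "l < n" for l
    using R[OF that] finite_subset[of "R l" "{..<n}"] by (simp_all add: subsets_of_card_def)
  have sum_z: "sum z (R l) = - (int d * v)" if "l < n" "l \<noteq> i" for l
    using y(2)[OF that] R'[OF that(1)] by (simp add: z_def sum_subtractf)
  have "(if i = 0 then 1 else 0) < n \<and> (if i = 0 then 1 else 0) \<noteq> i" using assms(1) by simp
  then obtain l0 where l0: "l0 < n" "l0 \<noteq> i" by blast
  \<comment> \<open>If \<open>y\<close> were constant, its nonzero value \<open>v\<close> would give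
    row \<open>l0\<close> the sum \<open>d * v\<close> instead of 0. This uses \<open>0 < d\<close>
    and the existence of a row other than \<open>i\<close>.\<close>
  have "\<exists>j<n. z j \<noteq> 0"
  proof (rule ccontr)
    assume "\<not> (\<exists>j<n. z j \<noteq> 0)"
    then have z: "\<And>j. j < n \<Longrightarrow> z j = 0" by simp
    then have "\<And>j. j < n \<Longrightarrow> y j = v" by (simp add: z_def)
    moreover from this have "v \<noteq> 0" using y(1) by auto
    moreover have "sum z (R l0) = 0"
      using z R'(1)[OF l0(1)] by (intro sum.neutral) auto
    ultimately show False using sum_z[OF l0] assms(2) by simp
  qed
  then have "\<exists>j\<in>{..<n}. z j \<noteq> 0" by auto
  then obtain g z' where gz: "g \<noteq> 0" "\<forall>j\<in>{..<n}. z j = g * z' j" and odd: "\<exists>j\<in>{..<n}. odd (z' j)"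
    by (rule odd_multiple)
  define T where "T = {j. j < n \<and> odd (z' j)}"
  have "y j \<noteq> v" if "j < n" "odd (z' j)" for j
  proof -
    have "z' j \<noteq> 0" using that(2) by auto
    then have "z j \<noteq> 0" using gz(1) gz(2) that(1) by simp
    then show ?thesis by (simp add: z_def)
  qed
  then have "T \<subseteq> {j. j < n \<and> y j \<noteq> v}" by (auto simp: T_def)
  then have "card T \<le> card {j. j < n \<and> y j \<noteq> v}" by (intro card_mono) auto
  moreover have "even (card (R l \<inter> T)) = even (sum z' (R l0))" if l: "l < n" "l \<noteq> i" for l
  proof -
    have g: "g * sum z' (R k) = sum z (R k)" if "k < n" for k
      unfolding sum_distrib_left using R'(1)[OF that] gz(2) by (intro sum.cong) auto
    then have "g * sum z' (R l) = g * sum z' (R l0)" using sum_z l l0 by simp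
    then have "sum z' (R l) = sum z' (R l0)" using gz(1) by simp
    moreover have "{a \<in> R l. odd (z' a)} = R l \<inter> T" using R'(1)[OF l(1)] by (auto simp: T_def)
    ultimately show ?thesis using even_sum_iff[OF R'(2)[OF l(1)], of z'] by simp
  qed
  ultimately show ?thesis
    using v odd by (intro exI[of _ T]) (auto simp: T_def)
qed

section \<open>The union bound over sparse sets\<close>

lemma sum_power_card_Pow:
  fixes y :: real
  assumes "finite V"
  shows "(\<Sum>S\<in>Pow V. y ^ card S) = (1 + y) ^ card V"
proof -
  have "(1 + y) ^ card V = (\<Prod>j\<in>V. y + 1)" by (simp add: add.commute)
  also have "\<dots> = (\<Sum>S\<in>Pow V. y ^ card S)" using assms by (subst prod_add) auto
  finally show ?thesis by simp
qed

text \<open>Exponential Markov bound: since \<open>y \<le> 1\<close>, each counted set has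
  \<open>y powr (card S - s) \<ge> 1\<close>, and the sum over all sets is a binomial
  expansion.\<close>

lemma card_small_subsets:
  fixes s y :: real
  assumes "finite V" "0 < y" "y \<le> 1"
  shows "real (card {S \<in> Pow V. real (card S) \<le> s}) \<le> y powr (- s) * (1 + y) ^ card V"
proof -
  have "real (card {S \<in> Pow V. real (card S) \<le> s}) \<le> (\<Sum>S\<in>{S \<in> Pow V. real (card S) \<le> s}. y powr (- s) * y ^ card S)"
  proof (subst real_of_card, rule sum_mono)
    fix S assume S: "S \<in> {S \<in> Pow V. real (card S) \<le> s}"
    have "y powr 0 \<le> y powr (- s + real (card S))" using S assms by (intro powr_mono') auto
    then show "1 \<le> y powr (- s) * y ^ card S" using assms by (simp only: powr_add powr_realpow) simp
  qed
  also have "\<dots> \<le> (\<Sum>S\<in>Pow V. y powr (- s) * y ^ card S)"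
    using assms by (intro sum_mono2) auto
  also have "\<dots> = y powr (- s) * (1 + y) ^ card V"
    unfolding sum_distrib_left[symmetric] sum_power_card_Pow[OF assms(1)] ..
  finally show ?thesis .
qed

text \<open>In this range the bound is a \<open>k\<close>-th power, which a binomial expansion sums
  over all sets, and the exponent loses only the factor 1 + 8 \<eta>.\<close>

lemma decay_small:
  assumes "0 < L" "0 < n" "0 < \<eta>" "real k * L \<le> \<eta> * real n"
  shows "decay L n k \<le> (12 * L * exp (- (L / (1 + 8 * \<eta>)))) ^ k"
proof -
  have "8 * real k * L / real n \<le> 8 * \<eta>" using assms by (simp add: field_simps)
  then have "real k * L / (1 + 8 * \<eta>) \<le> real k * L / (1 + 8 * real k * L / real n)"
    using assms by (intro divide_left_mono) (auto intro!: mult_pos_pos add_pos_nonneg)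
  then have "decay L n k \<le> (12 * L) ^ k * exp (- (real k * L / (1 + 8 * \<eta>)))"
    unfolding decay_def using assms by (intro mult_left_mono) auto
  also have "exp (- (real k * L / (1 + 8 * \<eta>))) = exp (- (L / (1 + 8 * \<eta>))) ^ k"
    by (simp flip: exp_of_nat_mult)
  finally show ?thesis by (simp add: power_mult_distrib)
qed

text \<open>For k L about \<eta> n the saving is exponential in n, while \<open>(12 * L) ^ k\<close>
  has exponent about \<eta> n ln (12 L) / L, which is o(n) when L tends to infinity.\<close>

lemma decay_large:
  assumes "1 \<le> 12 * L" "0 < n" "0 < \<eta>" "\<eta> * real n \<le> real k * L" "real k \<le> \<eta> * real n / L + 1"
  defines "\<delta> \<equiv> \<eta> / (1 + 8 * \<eta>)"
  shows "decay L n k \<le> exp ((\<eta> * real n / L + 1) * ln (12 * L) - \<delta> * real n)"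
proof -
  have L: "0 < L" using assms(1) by simp
  have "(12 * L) ^ k = exp (real k * ln (12 * L))" using L by (simp add: exp_of_nat_mult)
  also have "\<dots> \<le> exp ((\<eta> * real n / L + 1) * ln (12 * L))"
    using assms by (auto intro!: mult_right_mono)
  finally have 1: "(12 * L) ^ k \<le> exp ((\<eta> * real n / L + 1) * ln (12 * L))" .
  define x where "x = real k * L / real n"
  have x: "\<eta> \<le> x" using assms by (simp add: x_def field_simps)
  have "\<delta> \<le> x / (1 + 8 * x)"
    unfolding \<delta>_def using x assms(3) by (simp add: divide_simps) (simp add: algebra_simps)
  then have "\<delta> * real n \<le> x / (1 + 8 * x) * real n" by (intro mult_right_mono) auto
  also have "\<dots> = real k * L / (1 + 8 * real k * L / real n)"
    using assms(2) by (simp add: x_def)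
  finally have 2: "exp (- (real k * L / (1 + 8 * real k * L / real n))) \<le> exp (- (\<delta> * real n))" by simp
  have "decay L n k \<le> exp ((\<eta> * real n / L + 1) * ln (12 * L)) * exp (- (\<delta> * real n))"
    unfolding decay_def using L by (intro mult_mono 1 2) auto
  then show ?thesis by (simp flip: exp_add)
qed

text \<open>If \<open>m * L\<close> is large compared to \<open>n\<close>, then \<open>decay L n m\<close> itself is useless because of its factor
  \<open>(12 * L) ^ m\<close>; the bound is then taken at the smaller \<open>k\<close> with \<open>k * L\<close> about \<open>\<eta> * n\<close>.\<close>

lemma decay_cases:
  assumes "1 \<le> 12 * L" "0 < n" "0 < \<eta>" "1 \<le> m"
    and W: "\<And>k. 1 \<le> k \<Longrightarrow> k \<le> m \<Longrightarrow> W \<le> decay L n k"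
  shows "W \<le> (12 * L * exp (- (L / (1 + 8 * \<eta>)))) ^ m
    + exp ((\<eta> * real n / L + 1) * ln (12 * L) - \<eta> / (1 + 8 * \<eta>) * real n)"
proof -
  have L: "0 < L" using assms(1) by simp
  show ?thesis
  proof (cases "real m * L \<le> \<eta> * real n")
    case True
    have "W \<le> (12 * L * exp (- (L / (1 + 8 * \<eta>)))) ^ m"
      using W[of m] decay_small[OF L assms(2,3) True] assms(4) by simp
    then show ?thesis by (simp add: add_increasing2)
  next
    case False
    define k where "k = nat \<lceil>\<eta> * real n / L\<rceil>"
    have pos: "0 < \<eta> * real n / L" using assms L by simp
    have k: "\<eta> * real n / L \<le> real k" "real k \<le> \<eta> * real n / L + 1"
      using pos unfolding k_def by linarith+
    have "1 \<le> k" using pos k(1) by (cases k) auto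
    moreover have "\<eta> * real n / L \<le> real m" using False L by (simp add: field_simps)
    then have "k \<le> m" unfolding k_def by (simp add: nat_le_iff ceiling_le_iff)
    ultimately have "W \<le> decay L n k" by (rule W)
    also have "\<dots> \<le> exp ((\<eta> * real n / L + 1) * ln (12 * L) - \<eta> / (1 + 8 * \<eta>) * real n)"
      using assms(1-3) k L by (intro decay_large) (auto simp: field_simps)
    finally show ?thesis using L by (simp add: add_increasing)
  qed
qed

text \<open>\<open>W\<close> is quantified after \<open>c\<close> and \<open>r\<close>, so the same
  constants serve for both sparse events. A set \<open>S\<close> is charged
  \<open>\<theta> n ^ card S\<close> plus exp (-\<delta> n / 2). The first terms sum to at most exp
  (n \<theta>) - 1; the second is multiplied by the number of sparse sets, at most exp (\<delta> n /
  4).\<close>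

lemma sum_decay_tendsto_0:
  fixes L :: "nat \<Rightarrow> real"
  assumes "0 < \<epsilon>" and lower: "\<forall>\<^sub>F n in sequentially. (1 + \<epsilon>) * ln (real n) \<le> L n"
    and upper: "\<forall>\<^sub>F n in sequentially. L n \<le> real n"
  obtains c r where "0 < c" "c \<le> 1 / 2" "r \<longlonglongrightarrow> 0"
    "\<forall>\<^sub>F n in sequentially. \<forall>W.
      (\<forall>S k. S \<subseteq> {..<n} \<longrightarrow> 1 \<le> k \<longrightarrow> k \<le> card S \<longrightarrow> real (card S) \<le> c * real n \<longrightarrow> W S \<le> decay (L n) n k) \<longrightarrow>
      (\<Sum>S | S \<subseteq> {..<n} \<and> S \<noteq> {} \<and> real (card S) \<le> c * real n. W S) \<le> (r n :: real)"
proof -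
  \<comment> \<open>This makes 1 + 8 \<eta> equal to 1 + \<epsilon> / 2, strictly below 1 +
    \<epsilon>.\<close>
  define \<eta> where "\<eta> = \<epsilon> / 16"
  define \<delta> where "\<delta> = \<eta> / (1 + 8 * \<eta>)"
  \<comment> \<open>The values of \<open>y\<close> and \<open>c\<close> make both factors of
    \<open>card_small_subsets\<close> at most exp (\<delta> n / 8). The cap 1 / 2 on
    \<open>c\<close> leaves room to match a sparse set into its complement.\<close>
  define y where "y = \<delta> / 8"
  define c where "c = min (1 / 2) (\<delta> / (8 * ln (1 / y)))"
  define \<theta> where "\<theta> n = 12 * L n * exp (- (L n / (1 + 8 * \<eta>)))" for n
  define r where "r n = (exp (real n * \<theta> n) - 1) + exp (- (\<delta> / 4 * real n))" for n
  have \<eta>: "0 < \<eta>" and \<delta>: "0 < \<delta>" using assms(1) by (auto simp: \<eta>_def \<delta>_def)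
  have "\<delta> < 1" using \<eta> by (simp add: \<delta>_def)
  then have y: "0 < y" "y < 1" using \<delta> by (auto simp: y_def)
  then have lny: "0 < ln (1 / y)" by simp
  have c: "0 < c" "c \<le> 1 / 2" "c * ln (1 / y) \<le> \<delta> / 8"
  proof -
    show "0 < c" "c \<le> 1 / 2" using \<delta> lny by (auto simp: c_def)
    have "c * ln (1 / y) \<le> \<delta> / (8 * ln (1 / y)) * ln (1 / y)"
      using lny by (intro mult_right_mono) (auto simp: c_def)
    then show "c * ln (1 / y) \<le> \<delta> / 8" using lny by simp
  qed
  have L_top: "filterlim L at_top sequentially"
  proof (rule filterlim_at_top_mono[OF _ lower])
    show "filterlim (\<lambda>n. (1 + \<epsilon>) * ln (real n)) at_top sequentially"
      using assms(1) by real_asymp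
  qed
  define \<kappa> where "\<kappa> = 1 / (1 + 8 * \<eta>) - 1 / (1 + \<epsilon>)"
  have \<kappa>: "0 < \<kappa>"
    unfolding \<kappa>_def using assms(1) by (simp add: \<eta>_def divide_strict_left_mono)
  have n\<theta>: "(\<lambda>n. real n * \<theta> n) \<longlonglongrightarrow> 0"
  proof (rule tendsto_sandwich[of "\<lambda>_. 0" _ _ "\<lambda>n. 12 * L n * exp (- (\<kappa> * L n))"])
    show "\<forall>\<^sub>F n in sequentially. 0 \<le> real n * \<theta> n"
      using filterlim_at_top_dense[THEN iffD1, OF L_top, rule_format, of 0]
      by eventually_elim (auto simp: \<theta>_def)
    show "\<forall>\<^sub>F n in sequentially. real n * \<theta> n \<le> 12 * L n * exp (- (\<kappa> * L n))"
      using filterlim_at_top_dense[THEN iffD1, OF L_top, rule_format, of 0] lower eventually_gt_at_top[of 0]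
    proof eventually_elim
      case (elim n)
      \<comment> \<open>The lower bound on \<open>L\<close> is spent here: the n choices of one
        element cost exp (L / (1 + \<epsilon>)), less than the saving exp (L / (1 + 8 \<eta>)). The
        gap between the exponents is \<kappa> L.\<close>
      have "ln (real n) \<le> L n / (1 + \<epsilon>)" using elim assms(1) by (simp add: field_simps)
      then have "exp (ln (real n)) \<le> exp (L n / (1 + \<epsilon>))" by simp
      then have "real n \<le> exp (L n / (1 + \<epsilon>))" using elim by simp
      then have "real n * \<theta> n \<le> exp (L n / (1 + \<epsilon>)) * \<theta> n"
        using elim by (intro mult_right_mono) (auto simp: \<theta>_def)
      also have "\<dots> = 12 * L n * (exp (L n / (1 + \<epsilon>)) * exp (- (L n / (1 + 8 * \<eta>))))"
        by (simp add: \<theta>_def)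
      also have "\<dots> = 12 * L n * exp (- (\<kappa> * L n))"
        unfolding exp_add[symmetric] by (simp add: \<kappa>_def algebra_simps)
      finally show ?case .
    qed
    have "((\<lambda>x. 12 * x * exp (- (\<kappa> * x))) \<longlongrightarrow> 0) at_top" using \<kappa> by real_asymp
    then show "(\<lambda>n. 12 * L n * exp (- (\<kappa> * L n))) \<longlonglongrightarrow> 0"
      by (rule filterlim_compose[OF _ L_top])
  qed simp
  have "r \<longlonglongrightarrow> 0"
  proof -
    have "(\<lambda>n. exp (- (\<delta> / 4 * real n))) \<longlonglongrightarrow> 0" using \<delta> by real_asymp
    moreover have "(\<lambda>n. exp (real n * \<theta> n)) \<longlonglongrightarrow> exp 0" by (intro tendsto_exp n\<theta>)
    ultimately have "(\<lambda>n. (exp (real n * \<theta> n) - 1) + exp (- (\<delta> / 4 * real n))) \<longlonglongrightarrow> (exp 0 - 1) + 0"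
      by (intro tendsto_add tendsto_diff tendsto_const)
    then show ?thesis by (simp add: r_def[abs_def])
  qed
  moreover have "\<forall>\<^sub>F n in sequentially. \<forall>W.
      (\<forall>S k. S \<subseteq> {..<n} \<longrightarrow> 1 \<le> k \<longrightarrow> k \<le> card S \<longrightarrow> real (card S) \<le> c * real n \<longrightarrow> W S \<le> decay (L n) n k) \<longrightarrow>
      (\<Sum>S | S \<subseteq> {..<n} \<and> S \<noteq> {} \<and> real (card S) \<le> c * real n. W S) \<le> r n"
  proof -
    have "((\<lambda>x. \<eta> * ln (12 * x) / x) \<longlongrightarrow> 0) at_top" by real_asymp
    then have "(\<lambda>n. \<eta> * ln (12 * L n) / L n) \<longlonglongrightarrow> 0" by (rule filterlim_compose[OF _ L_top])
    then have e1: "\<forall>\<^sub>F n in sequentially. \<eta> * ln (12 * L n) / L n < \<delta> / 4"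
      using \<delta> by (intro order_tendstoD) auto
    have e2: "\<forall>\<^sub>F n in sequentially. ln (12 * real n) \<le> \<delta> / 4 * real n" using \<delta> by real_asymp
    have e3: "\<forall>\<^sub>F n in sequentially. 1 < L n"
      using L_top by (auto simp: filterlim_at_top_dense)
    show ?thesis
      using e1 e2 e3 upper eventually_gt_at_top[of 0]
    proof eventually_elim
      case (elim n)
      show ?case
      proof (intro allI impI)
        fix W assume W: "\<forall>S k. S \<subseteq> {..<n} \<longrightarrow> 1 \<le> k \<longrightarrow> k \<le> card S \<longrightarrow> real (card S) \<le> c * real n \<longrightarrow> W S \<le> decay (L n) n k"
        let ?F = "{S. S \<subseteq> {..<n} \<and> S \<noteq> {} \<and> real (card S) \<le> c * real n}"
        have finF: "finite ?F" by (rule finite_subset[of _ "Pow {..<n}"]) auto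
        have \<theta>: "0 \<le> \<theta> n" using elim by (simp add: \<theta>_def)
        have "(\<eta> * real n / L n + 1) * ln (12 * L n) = \<eta> * ln (12 * L n) / L n * real n + ln (12 * L n)"
          by (simp add: algebra_simps)
        also have "\<dots> \<le> \<delta> / 4 * real n + \<delta> / 4 * real n"
        proof (rule add_mono)
          have "ln (12 * L n) \<le> ln (12 * real n)" using elim by simp
          then show "ln (12 * L n) \<le> \<delta> / 4 * real n" using elim by linarith
        qed (use elim in \<open>intro mult_right_mono; simp\<close>)
        also have "\<dots> = - (\<delta> / 2 * real n) + \<delta> * real n" by simp
        finally have exponent: "(\<eta> * real n / L n + 1) * ln (12 * L n) - \<delta> * real n \<le> - (\<delta> / 2 * real n)"
          by (simp only: diff_le_eq)
        have "W S \<le> \<theta> n ^ card S + exp (- (\<delta> / 2 * real n))" if "S \<in> ?F" for S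
        proof -
          have "finite S" using that finite_subset by blast
          then have "1 \<le> card S" using that by (simp add: Suc_leI card_gt_0_iff)
          then have "W S \<le> \<theta> n ^ card S + exp ((\<eta> * real n / L n + 1) * ln (12 * L n) - \<delta> * real n)"
            unfolding \<theta>_def \<delta>_def using W that elim \<eta> by (intro decay_cases) auto
          then show ?thesis using exponent by (smt (verit) exp_le_cancel_iff)
        qed
        then have "(\<Sum>S\<in>?F. W S) \<le> (\<Sum>S\<in>?F. \<theta> n ^ card S + exp (- (\<delta> / 2 * real n)))"
          by (intro sum_mono)
        also have "\<dots> = (\<Sum>S\<in>?F. \<theta> n ^ card S) + real (card ?F) * exp (- (\<delta> / 2 * real n))"
          by (simp add: sum.distrib)
        also have "(\<Sum>S\<in>?F. \<theta> n ^ card S) \<le> exp (real n * \<theta> n) - 1"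
        proof -
          have "(\<Sum>S\<in>?F. \<theta> n ^ card S) \<le> (\<Sum>S\<in>Pow {..<n} - {{}}. \<theta> n ^ card S)"
            using \<theta> by (intro sum_mono2) auto
          also have "\<dots> = (1 + \<theta> n) ^ n - 1"
            using sum_power_card_Pow[of "{..<n}" "\<theta> n"] by (simp add: sum_diff1)
          also have "(1 + \<theta> n) ^ n \<le> exp (\<theta> n) ^ n"
            using \<theta> by (intro power_mono) (auto simp: exp_ge_add_one_self)
          finally show ?thesis by (simp add: exp_of_nat_mult)
        qed
        also have "real (card ?F) \<le> exp (\<delta> / 4 * real n)"
        proof -
          have "real (card ?F) \<le> real (card {S \<in> Pow {..<n}. real (card S) \<le> c * real n})"
            by (simp, intro card_mono) auto
          also have "\<dots> \<le> y powr (- (c * real n)) * (1 + y) ^ card {..<n}"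
            using y by (intro card_small_subsets) auto
          also have "\<dots> \<le> exp (\<delta> / 8 * real n) * exp (\<delta> / 8 * real n)"
          proof (rule mult_mono)
            have "y powr (- (c * real n)) = exp (c * ln (1 / y) * real n)"
              using y by (simp add: powr_def ln_div mult_ac)
            also have "\<dots> \<le> exp (\<delta> / 8 * real n)" using mult_right_mono[OF c(3), of "real n"] by simp
            finally show "y powr (- (c * real n)) \<le> exp (\<delta> / 8 * real n)" .
            have "(1 + y) ^ card {..<n} \<le> exp y ^ n"
              using y by (simp, intro power_mono) (auto simp: exp_ge_add_one_self)
            then show "(1 + y) ^ card {..<n} \<le> exp (\<delta> / 8 * real n)"
              by (simp add: y_def mult.commute flip: exp_of_nat_mult)
          qed (use y in auto)
          also have "\<dots> = exp (\<delta> / 4 * real n)" unfolding exp_add[symmetric] by simp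
          finally show ?thesis .
        qed
        also have "exp (\<delta> / 4 * real n) * exp (- (\<delta> / 2 * real n)) = exp (- (\<delta> / 4 * real n))"
          unfolding exp_add[symmetric] by (simp add: algebra_simps)
        finally show "(\<Sum>S\<in>?F. W S) \<le> r n" by (simp add: r_def)
      qed
    qed
  qed
  ultimately show ?thesis using that c by blast
qed

section \<open>Singularity of the random matrix\<close>

definition row_sets_pmf :: "nat \<Rightarrow> nat \<Rightarrow> (nat \<Rightarrow> nat set) pmf" where
  "row_sets_pmf n d = Pi_pmf {..<n} {} (\<lambda>_. row_pmf n d)"

lemma random_zero_one_mat_incidence:
  assumes "d \<le> n"
  shows "random_zero_one_mat n d = map_pmf (incidence_mat n) (row_sets_pmf n d)"
proof -
  define g :: "nat set \<Rightarrow> real vec" where "g R = vec n (\<lambda>j. of_bool (j \<in> R))" for R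
  have g_one: "{j. j < n \<and> g R $ j = 1} = R" if "R \<subseteq> {..<n}" for R
    using that by (auto simp: g_def)
  have inj: "inj_on g (subsets_of_card n d)"
    by (rule inj_on_inverseI[of _ "\<lambda>v. {j. j < n \<and> v $ j = 1}"]) (simp add: g_one subsets_of_card_def)
  have "g ` subsets_of_card n d = zero_one_vecs n d"
  proof (intro equalityI subsetI)
    fix v assume "v \<in> g ` subsets_of_card n d"
    then obtain R where R: "R \<subseteq> {..<n}" "card R = d" "v = g R" by (auto simp: subsets_of_card_def)
    then show "v \<in> zero_one_vecs n d"
      using g_one[OF R(1)] by (auto simp: zero_one_vecs_def g_def)
  next
    fix v assume v: "v \<in> zero_one_vecs n d"
    have "v = g {j. j < n \<and> v $ j = 1}"
      using v by (intro eq_vecI) (auto simp: zero_one_vecs_def g_def)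
    moreover have "{j. j < n \<and> v $ j = 1} \<in> subsets_of_card n d"
      using v by (auto simp: zero_one_vecs_def subsets_of_card_def)
    ultimately show "v \<in> g ` subsets_of_card n d" by (rule image_eqI)
  qed
  then have "pmf_of_set (zero_one_vecs n d) = map_pmf g (row_pmf n d)"
    using map_pmf_of_set_inj[OF inj subsets_of_card_nonempty[OF assms]] by simp
  \<comment> \<open>Mapping the product measure requires the default row \<open>{}\<close> to go to
    the default vector.\<close>
  moreover have "g {} = 0\<^sub>v n" by (auto simp: g_def)
  ultimately have "Pi_pmf {..<n} (0\<^sub>v n) (\<lambda>_. pmf_of_set (zero_one_vecs n d))
      = map_pmf (\<lambda>h. g \<circ> h) (row_sets_pmf n d)"
    unfolding row_sets_pmf_def by (simp add: Pi_pmf_map)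
  then have "random_zero_one_mat n d = map_pmf (\<lambda>h. mat n n (\<lambda>(i, j). g (h i) $ j)) (row_sets_pmf n d)"
    by (simp add: random_zero_one_mat_def map_pmf_comp)
  also have "(\<lambda>h. mat n n (\<lambda>(i, j). g (h i) $ j)) = incidence_mat n"
    by (intro ext eq_matI) (auto simp: incidence_mat_def g_def)
  finally show ?thesis .
qed

lemma prob_many_events_le:
  fixes M :: "'a pmf" and n :: nat
  assumes "0 < t"
  shows "measure_pmf.prob M {x. t \<le> real (card {i. i < n \<and> E x i})} \<le> (\<Sum>i<n. measure_pmf.prob M {x. E x i}) / t"
proof -
  let ?A = "{x. t \<le> real (card {i. i < n \<and> E x i})}"
  have int: "integrable (measure_pmf M) (indicator A :: 'a \<Rightarrow> real)" for A
    by (rule measure_pmf.integrable_const_bound[of _ 1]) (auto simp: indicator_def)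
  have "t * measure_pmf.prob M ?A = measure_pmf.expectation M (\<lambda>x. t * indicator ?A x)" by simp
  also have "\<dots> \<le> measure_pmf.expectation M (\<lambda>x. \<Sum>i<n. indicator {x. E x i} x)"
  proof (rule integral_mono)
    fix x
    have "(\<Sum>i<n. indicator {x. E x i} x :: real) = real (card {i. i < n \<and> E x i})"
    proof -
      have "(\<Sum>i<n. indicator {x. E x i} x) = (\<Sum>i<n. of_bool (E x i) :: real)"
        by (intro sum.cong) (auto simp: indicator_def)
      also have "\<dots> = real (card ({..<n} \<inter> {i. E x i}))" by simp
      also have "{..<n} \<inter> {i. E x i} = {i. i < n \<and> E x i}" by auto
      finally show ?thesis .
    qed
    then show "t * indicator ?A x \<le> (\<Sum>i<n. indicator {x. E x i} x :: real)"
      by (auto simp: indicator_def)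
  qed (auto intro!: int Bochner_Integration.integrable_sum integrable_mult_right)
  also have "\<dots> = (\<Sum>i<n. measure_pmf.prob M {x. E x i})"
    by (subst Bochner_Integration.integral_sum) (auto intro!: int)
  finally show ?thesis using assms by (simp add: field_simps)
qed

text \<open>Row \<open>i\<close> is drawn last. If the other rows have a sparse set of constant
  parity, the event on the right occurs whatever row \<open>i\<close> is. Otherwise their kernel
  vector \<open>y\<close> has no dominant value, and \<open>C\<close> bounds the probability that
  row \<open>i\<close> is orthogonal to it.\<close>

lemma prob_row_dependent_le:
  assumes "2 \<le> n" "0 < d" "d \<le> n" "i < n" and C: "0 \<le> C" "\<And>y :: nat \<Rightarrow> int. (\<And>v. t \<le> real (card {j. j < n \<and> y j \<noteq> v}))
    \<Longrightarrow> measure_pmf.prob (row_pmf n d) {X. sum y X = 0} \<le> C"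
  shows "measure_pmf.prob (row_sets_pmf n d) {R. dependent_row n R i}
    \<le> measure_pmf.prob (row_sets_pmf n d) {R. \<exists>T. T \<subseteq> {..<n} \<and> T \<noteq> {} \<and> real (card T) < t
        \<and> (\<exists>b. \<forall>l<n. l \<noteq> i \<longrightarrow> even (card (R l \<inter> T)) = b)} + C"
    (is "?lhs \<le> measure_pmf.prob _ {R. ?II R} + C")
proof -
  let ?row = "row_pmf n d" and ?P = "Pi_pmf ({..<n} - {i}) {} (\<lambda>_. row_pmf n d)"
  have "{..<n} = insert i ({..<n} - {i})" using assms(4) by auto
  then have "row_sets_pmf n d = Pi_pmf (insert i ({..<n} - {i})) {} (\<lambda>_. row_pmf n d)"
    unfolding row_sets_pmf_def by metis
  also have "\<dots> = ?row \<bind> (\<lambda>X. ?P \<bind> (\<lambda>f. return_pmf (f(i := X))))"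
    by (rule Pi_pmf_insert') auto
  also have "\<dots> = ?P \<bind> (\<lambda>f. map_pmf (\<lambda>X. f(i := X)) ?row)"
    by (subst bind_commute_pmf) (simp add: map_pmf_def)
  finally have rows: "row_sets_pmf n d = ?P \<bind> (\<lambda>f. map_pmf (\<lambda>X. f(i := X)) ?row)" .
  have fibre: "measure_pmf.prob (map_pmf (\<lambda>X. f(i := X)) ?row) {R. dependent_row n R i \<and> \<not> ?II R} \<le> C"
    if f: "f \<in> set_pmf ?P" for f
  proof (cases "?II f")
    case True
    have "?II (f(i := X))" for X using True by (simp cong: conj_cong)
    then have "(\<lambda>X. f(i := X)) -` {R. dependent_row n R i \<and> \<not> ?II R} = {}" by blast
    then show ?thesis using C(1) by (simp only: measure_map_pmf measure_empty)
  next
    case False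
    \<comment> \<open>\<open>{..<d}\<close> is a placeholder: \<open>sparse_kernel_parity\<close>
      expects a full family of \<open>d\<close>-subsets, while its conclusion concerns only the rows
      other than \<open>i\<close>.\<close>
    define R0 where "R0 = f(i := {..<d})"
    have fl: "f l \<in> subsets_of_card n d" if "l < n" "l \<noteq> i" for l
      using f that set_pmf_of_set[OF subsets_of_card_nonempty[OF assms(3)]]
      by (auto simp: set_Pi_pmf PiE_dflt_def)
    have R0: "R0 l \<in> subsets_of_card n d" if "l < n" for l
      using fl[OF that] assms(3) by (auto simp: R0_def subsets_of_card_def)
    then have "R0 l \<subseteq> {..<n}" if "l < n" for l using that by (auto simp: subsets_of_card_def)
    then obtain y :: "nat \<Rightarrow> int" where y: "\<exists>j<n. y j \<noteq> 0" "\<forall>l<n. l \<noteq> i \<longrightarrow> sum y (R0 l) = 0"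
      using right_kernel_of_other_rows[OF assms(4), of R0] by blast
    have spread: "t \<le> real (card {j. j < n \<and> y j \<noteq> v})" for v
    proof (rule ccontr)
      assume "\<not> ?thesis"
      then have "?II R0"
        using sparse_kernel_parity[OF assms(1,2) R0 y(1), where i = i and v = v and t = t] y(2) by simp
      then have "?II f" by (simp add: R0_def cong: conj_cong)
      then show False using False by simp
    qed
    have "measure_pmf.prob (map_pmf (\<lambda>X. f(i := X)) ?row) {R. dependent_row n R i \<and> \<not> ?II R}
        = measure_pmf.prob ?row ({X. dependent_row n (f(i := X)) i \<and> \<not> ?II (f(i := X))} \<inter> set_pmf ?row)"
      unfolding measure_map_pmf vimage_def measure_Int_set_pmf mem_Collect_eq ..
    also have "\<dots> \<le> measure_pmf.prob ?row {X. sum y X = 0}"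
    proof (rule measure_pmf.finite_measure_mono)
      show "{X. dependent_row n (f(i := X)) i \<and> \<not> ?II (f(i := X))} \<inter> set_pmf ?row \<subseteq> {X. sum y X = 0}"
      proof clarify
        fix X assume dep: "dependent_row n (f(i := X)) i" and X: "X \<in> set_pmf ?row"
        have "X \<subseteq> {..<n}"
          using X set_pmf_of_set[OF subsets_of_card_nonempty[OF assms(3)]] by (auto simp: subsets_of_card_def)
        then have "(f(i := X)) l \<subseteq> {..<n}" if "l < n" for l
          using fl[OF that] by (auto simp: subsets_of_card_def)
        moreover have "sum y ((f(i := X)) l) = 0" if "l < n" "l \<noteq> i" for l
          using y(2) that by (simp add: R0_def)
        ultimately show "sum y X = 0"
          using dependent_row_kernel[OF dep assms(4), of y] by simp
      qed
    qed simp
    also have "\<dots> \<le> C" by (rule C(2)[OF spread])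
    finally show ?thesis .
  qed
  have "measure_pmf.prob (row_sets_pmf n d) {R. dependent_row n R i \<and> \<not> ?II R}
      = measure_pmf.expectation ?P (\<lambda>f. measure_pmf.prob (map_pmf (\<lambda>X. f(i := X)) ?row) {R. dependent_row n R i \<and> \<not> ?II R})"
    unfolding rows by (rule measure_bind_pmf)
  also have "\<dots> \<le> measure_pmf.expectation ?P (\<lambda>_. C)"
  proof (rule integral_mono_AE)
    show "integrable (measure_pmf ?P) (\<lambda>f. measure_pmf.prob (map_pmf (\<lambda>X. f(i := X)) ?row) {R. dependent_row n R i \<and> \<not> ?II R})"
      by (rule measure_pmf.integrable_const_bound[of _ 1]) auto
    show "AE f in measure_pmf ?P. measure_pmf.prob (map_pmf (\<lambda>X. f(i := X)) ?row) {R. dependent_row n R i \<and> \<not> ?II R} \<le> C"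
      by (rule AE_pmfI) (rule fibre)
  qed simp
  also have "\<dots> = C" by simp
  finally have rest: "measure_pmf.prob (row_sets_pmf n d) {R. dependent_row n R i \<and> \<not> ?II R} \<le> C" .
  have "?lhs \<le> measure_pmf.prob (row_sets_pmf n d) ({R. ?II R} \<union> {R. dependent_row n R i \<and> \<not> ?II R})"
    by (intro measure_pmf.finite_measure_mono) auto
  also have "\<dots> \<le> measure_pmf.prob (row_sets_pmf n d) {R. ?II R}
      + measure_pmf.prob (row_sets_pmf n d) {R. dependent_row n R i \<and> \<not> ?II R}"
    by (rule measure_Un_le) auto
  finally show ?thesis using rest by linarith
qed

section \<open>Union bounds for the random rows\<close>

lemma prob_row_eq: "d \<le> n \<Longrightarrow> measure_pmf.prob (row_pmf n d) {X. P X} = real (card {X \<in> subsets_of_card n d. P X}) / real (n choose d)"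
  by (simp add: measure_pmf_of_set subsets_of_card_nonempty card_subsets_of_card Collect_conj_eq)

text \<open>For a fixed parity the rows other than \<open>i\<close> are independent, so the bound
  for one row is raised to the power \<open>n - 1\<close>. The factor 2 accounts for the two
  parities.\<close>

lemma prob_rows_constant_parity_le:
  assumes "2 \<le> d" "d + 2 \<le> n" "8 \<le> n" "T \<subseteq> {..<n}" "2 * card T \<le> n" "i < n"
    and "1 \<le> 12 * row_variance n d" "k \<le> card T"
  shows "measure_pmf.prob (row_sets_pmf n d) {R. \<exists>b. \<forall>l<n. l \<noteq> i \<longrightarrow> even (card (R l \<inter> T)) = b}
    \<le> 2 * decay (row_variance n d) n k"
proof -
  define L where "L = row_variance n d"
  define q where "q = split_prob n d"
  define m where "m = real (card T) * q"
  have L: "0 < L" using assms(7) by (simp add: L_def)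
  have q: "0 < q" unfolding q_def using assms by (intro split_prob_pos) auto
  have qL: "real (n - 1) * q = 2 * L"
    using assms by (simp add: q_def L_def split_prob_def row_variance_def)
  have m: "0 \<le> m" using q by (simp add: m_def)
  \<comment> \<open>Here \<open>n \<le> 2 * (n - 1)\<close> turns \<open>q = 2 * L / (n - 1)\<close>
    into \<open>q \<le> 4 * L / n\<close>; the term \<open>2 * m\<close> then produces the 8 in
    \<open>decay\<close>.\<close>
  have mL: "m \<le> 4 * real (card T) * L / real n"
  proof -
    have "real n * q \<le> 2 * (real (n - 1) * q)" using assms q by (simp add: of_nat_diff mult_right_mono flip: mult.assoc)
    then have "q \<le> 4 * L / real n" using assms unfolding qL by (simp add: field_simps)
    then have "real (card T) * q \<le> real (card T) * (4 * L / real n)" by (intro mult_left_mono) auto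
    then show ?thesis by (simp add: m_def mult_ac)
  qed
  have one: "measure_pmf.prob (row_sets_pmf n d) {R. \<forall>l<n. l \<noteq> i \<longrightarrow> even (card (R l \<inter> T)) = b} \<le> decay L n k" for b
  proof -
    define p where "p = measure_pmf.prob (row_pmf n d) {X. even (card (X \<inter> T)) = b}"
    have "p \<le> 1 - m / (2 * (1 + 2 * m))"
      using card_even_inter_le[OF assms(1-5), of b] assms(2) unfolding p_def m_def q_def
      by (simp add: prob_row_eq divide_le_eq mult.commute)
    also have "\<dots> \<le> exp (- (m / (2 * (1 + 2 * m))))"
      using exp_ge_add_one_self[of "- (m / (2 * (1 + 2 * m)))"] by simp
    finally have "p \<le> exp (- (m / (2 * (1 + 2 * m))))" .
    then have "p ^ (n - 1) \<le> exp (- (m / (2 * (1 + 2 * m)))) ^ (n - 1)"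
      by (intro power_mono) (auto simp: p_def)
    also have "\<dots> = exp (- (real (n - 1) * q * real (card T) / 2 / (1 + 2 * m)))"
      unfolding exp_of_nat_mult[symmetric] by (simp add: m_def mult_ac)
    also have "real (n - 1) * q * real (card T) / 2 / (1 + 2 * m) = real (card T) * L / (1 + 2 * m)"
      unfolding qL by simp
    also have "exp (- (real (card T) * L / (1 + 2 * m))) \<le> exp (- (real k * L / (1 + 8 * real k * L / real n)))"
    proof -
      \<comment> \<open>\<open>h\<close> is increasing, so the exponent may be lowered from
        \<open>card T\<close> to \<open>k\<close>.\<close>
      define h where "h x = x / (1 + 8 * x / real n)" for x
      have h_mono: "h x \<le> h z" if "0 \<le> x" "x \<le> z" for x z
      proof -
        have "x * (1 + 8 * z / real n) \<le> z * (1 + 8 * x / real n)" using that by (simp add: algebra_simps)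
        moreover have "0 < 1 + 8 * x / real n" "0 < 1 + 8 * z / real n" using that by (auto intro!: add_pos_nonneg)
        ultimately show ?thesis unfolding h_def by (simp add: divide_le_eq le_divide_eq mult.commute)
      qed
      have "real k * L / (1 + 8 * real k * L / real n) = h (real k * L)" by (simp add: h_def mult.assoc)
      also have "\<dots> \<le> h (real (card T) * L)" using L assms(8) by (intro h_mono mult_right_mono) auto
      also have "\<dots> \<le> real (card T) * L / (1 + 2 * m)"
      proof -
        have "2 * m \<le> 2 * (4 * real (card T) * L / real n)" using mL by simp
        also have "\<dots> = 8 * (real (card T) * L) / real n" by simp
        finally show ?thesis
          unfolding h_def using m L by (intro divide_left_mono mult_pos_pos add_pos_nonneg add_left_mono) auto
      qed
      finally show ?thesis by simp
    qed
    \<comment> \<open>No conditioning is paid for here; the factor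
      \<open>(12 * L) ^ k \<ge> 1\<close> is inserted to reach the common bound.\<close>
    also have "\<dots> \<le> decay L n k"
    proof -
      have "1 * exp z \<le> (12 * L) ^ k * exp z" for z
        by (intro mult_right_mono one_le_power) (use assms(7) in \<open>simp_all add: L_def\<close>)
      then show ?thesis unfolding decay_def mult_1 .
    qed
    finally have "p ^ (n - 1) \<le> decay L n k" .
    moreover have "measure_pmf.prob (row_sets_pmf n d) {R. \<forall>l<n. l \<noteq> i \<longrightarrow> even (card (R l \<inter> T)) = b} = p ^ (n - 1)"
    proof -
      have "{R. \<forall>l<n. l \<noteq> i \<longrightarrow> even (card (R l \<inter> T)) = b}
          = Pi {..<n} (\<lambda>l. if l = i then UNIV else {X. even (card (X \<inter> T)) = b})"
        by (auto simp: Pi_def split: if_splits)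
      then have "measure_pmf.prob (row_sets_pmf n d) {R. \<forall>l<n. l \<noteq> i \<longrightarrow> even (card (R l \<inter> T)) = b}
          = (\<Prod>l<n. measure_pmf.prob (row_pmf n d) (if l = i then UNIV else {X. even (card (X \<inter> T)) = b}))"
        unfolding row_sets_pmf_def by (simp only: measure_Pi_pmf_Pi finite_lessThan)
      also have "\<dots> = (\<Prod>l<n. if l = i then 1 else p)"
        by (intro prod.cong) (auto simp: p_def)
      also have "\<dots> = p ^ (n - 1)"
        using assms(6) prod.remove[of "{..<n}" i "\<lambda>l. if l = i then 1 else p"] by simp
      finally show ?thesis .
    qed
    ultimately show ?thesis by simp
  qed
  have "{R. \<exists>b. \<forall>l<n. l \<noteq> i \<longrightarrow> even (card (R l \<inter> T)) = b}
      = {R. \<forall>l<n. l \<noteq> i \<longrightarrow> even (card (R l \<inter> T)) = True} \<union> {R. \<forall>l<n. l \<noteq> i \<longrightarrow> even (card (R l \<inter> T)) = False}"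
    unfolding ex_bool_eq by (rule Collect_disj_eq)
  then have "measure_pmf.prob (row_sets_pmf n d) {R. \<exists>b. \<forall>l<n. l \<noteq> i \<longrightarrow> even (card (R l \<inter> T)) = b}
      \<le> measure_pmf.prob (row_sets_pmf n d) {R. \<forall>l<n. l \<noteq> i \<longrightarrow> even (card (R l \<inter> T)) = True}
        + measure_pmf.prob (row_sets_pmf n d) {R. \<forall>l<n. l \<noteq> i \<longrightarrow> even (card (R l \<inter> T)) = False}"
    by (simp only:) (rule measure_Un_le; simp)
  then show ?thesis using one[of True] one[of False] unfolding L_def by linarith
qed

lemma prob_parity_event:
  assumes "S \<subseteq> {..<n}"
  shows "measure_pmf.prob (row_sets_pmf n d) (parity_event n S v) = parity_prob n d S v"
proof -
  have "(\<lambda>R x. if x \<in> S then R x else {}) -` parity_event n S v = parity_event n S v"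
    by (simp add: parity_event_def vimage_def cong: conj_cong)
  then show ?thesis
    unfolding parity_prob_def row_sets_pmf_def using assms by (simp only: Pi_pmf_subset[of "{..<n}" S] finite_lessThan measure_map_pmf)
qed

lemma prob_Ex_set_le:
  fixes M :: "'b pmf"
  assumes "finite F"
  shows "measure_pmf.prob M {x. \<exists>S\<in>F. E S x} \<le> (\<Sum>S\<in>F. measure_pmf.prob M {x. E S x})"
proof -
  have "{x. \<exists>S\<in>F. E S x} = (\<Union>S\<in>F. {x. E S x})" by auto
  then show ?thesis
    using measure_pmf.finite_measure_subadditive_finite[OF assms, of "\<lambda>S. {x. E S x}" M] by simp
qed

text \<open>\<open>r\<close> bounds the sparse row sets, \<open>2 * r\<close> the sparse column sets
  for one \<open>i\<close>, and \<open>C\<close> the chance that a row is orthogonal to a vector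
  without dominant value. Markov's inequality with t = c n divides the last two by
  \<open>c\<close>.\<close>

lemma prob_singular_le:
  assumes "2 \<le> d" "d + 2 \<le> n" "8 \<le> n" "0 < c" "c \<le> 1 / 2" and var: "1 \<le> row_variance n d"
    and r: "\<forall>W. (\<forall>S k. S \<subseteq> {..<n} \<longrightarrow> 1 \<le> k \<longrightarrow> k \<le> card S \<longrightarrow> real (card S) \<le> c * real n
        \<longrightarrow> W S \<le> decay (row_variance n d) n k) \<longrightarrow>
      (\<Sum>S | S \<subseteq> {..<n} \<and> S \<noteq> {} \<and> real (card S) \<le> c * real n. W S) \<le> (r :: real)"
  defines "L \<equiv> row_variance n d"
  defines "C \<equiv> 4 / (c * L) + 32 / real n + 1 / sqrt L + 2 * (sqrt L + 1) / (c * L)"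
  shows "measure_pmf.prob (random_zero_one_mat n d) {Q. \<not> invertible_mat Q} \<le> r + (2 * r + C) / c"
proof -
  let ?F = "{S. S \<subseteq> {..<n} \<and> S \<noteq> {} \<and> real (card S) \<le> c * real n}"
  let ?P = "row_sets_pmf n d"
  define t where "t = c * real n"
  have t: "0 < t" using assms by (simp add: t_def)
  have L: "1 \<le> L" using var by (simp add: L_def)
  have finF: "finite ?F" by (rule finite_subset[of _ "Pow {..<n}"]) auto
  define I where "I = {R. \<exists>S\<in>?F. R \<in> parity_event n S {}}"
  define II where "II i = {R. \<exists>T\<in>?F. \<exists>b. \<forall>l<n. l \<noteq> i \<longrightarrow> even (card (R l \<inter> T)) = b}" for i
  have fin: "finite S" if "S \<subseteq> {..<n}" for S :: "nat set" using that finite_subset by blast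
  have "measure_pmf.prob ?P I \<le> (\<Sum>S\<in>?F. measure_pmf.prob ?P {R. R \<in> parity_event n S {}})"
    unfolding I_def by (rule prob_Ex_set_le[OF finF])
  also have "\<dots> = (\<Sum>S\<in>?F. parity_prob n d S {})"
    by (intro sum.cong refl) (simp add: prob_parity_event)
  also have "\<dots> \<le> r"
    by (rule r[rule_format]) (rule parity_prob_le_decay, use assms fin in auto)
  finally have I: "measure_pmf.prob ?P I \<le> r" .
  have II: "measure_pmf.prob ?P (II i) \<le> 2 * r" if i: "i < n" for i
  proof -
    let ?W = "\<lambda>T. measure_pmf.prob ?P {R. \<exists>b. \<forall>l<n. l \<noteq> i \<longrightarrow> even (card (R l \<inter> T)) = b}"
    have "measure_pmf.prob ?P (II i) \<le> (\<Sum>T\<in>?F. ?W T)"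
      unfolding II_def by (rule prob_Ex_set_le[OF finF])
    moreover have "(\<Sum>T\<in>?F. ?W T / 2) \<le> r"
    proof (rule r[rule_format])
      fix T k assume T: "T \<subseteq> {..<n}" "k \<le> card T" "real (card T) \<le> c * real n"
      have "c * real n \<le> 1 / 2 * real n" using assms by (intro mult_right_mono) auto
      then have "2 * card T \<le> n" using T(3) by linarith
      then have "?W T \<le> 2 * decay (row_variance n d) n k"
        using assms i T var by (intro prob_rows_constant_parity_le) auto
      then show "?W T / 2 \<le> decay (row_variance n d) n k" by simp
    qed
    ultimately show ?thesis by (simp flip: sum_divide_distrib)
  qed
  have small_ball: "measure_pmf.prob (row_pmf n d) {X. sum y X = 0} \<le> C"
    if y: "\<And>v. t \<le> real (card {j. j < n \<and> y j \<noteq> v})" for y :: "nat \<Rightarrow> int"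
  proof -
    \<comment> \<open>With this \<open>J\<close> and \<open>m \<ge> c * L\<close>, both 1 / J and J
      / m are of order 1 / sqrt L.\<close>
    define J where "J = nat \<lceil>sqrt L\<rceil>"
    define m where "m = t / 2 * split_prob n d"
    have sqL: "1 \<le> sqrt L" using L by simp
    have J: "sqrt L \<le> real J" "real J \<le> sqrt L + 1" "0 < J" unfolding J_def using sqL by linarith+
    have "real (n - 1) * m = c * real n * L"
      using assms by (simp add: m_def t_def L_def split_prob_def row_variance_def)
    moreover have "real (n - 1) * (c * L) \<le> real n * (c * L)" using assms L by (intro mult_right_mono) auto
    ultimately have "real (n - 1) * (c * L) \<le> real (n - 1) * m" by (simp add: mult_ac)
    then have m: "c * L \<le> m" using assms by simp
    have cL: "0 < c * L" using assms L by simp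
    have "real (card {X \<in> subsets_of_card n d. sum y X = 0})
        \<le> real (n choose d) * (4 / m + 32 / real n + 1 / real J + 2 * real J / m)"
      unfolding m_def using assms t J y by (intro card_sum_subset_eq_le) auto
    then have "measure_pmf.prob (row_pmf n d) {X. sum y X = 0} \<le> 4 / m + 32 / real n + 1 / real J + 2 * real J / m"
      using assms(2) by (simp add: prob_row_eq divide_le_eq mult.commute)
    also have "\<dots> \<le> 4 / (c * L) + 32 / real n + 1 / sqrt L + 2 * (sqrt L + 1) / (c * L)"
      using m cL J sqL assms(3) by (intro add_mono frac_le) auto
    finally show ?thesis by (simp add: C_def)
  qed
  have C: "0 \<le> C" using assms L by (simp add: C_def)
  have dep: "measure_pmf.prob ?P {R. dependent_row n R i} \<le> 2 * r + C" if i: "i < n" for i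
  proof -
    have "measure_pmf.prob ?P {R. dependent_row n R i}
        \<le> measure_pmf.prob ?P {R. \<exists>T. T \<subseteq> {..<n} \<and> T \<noteq> {} \<and> real (card T) < t
          \<and> (\<exists>b. \<forall>l<n. l \<noteq> i \<longrightarrow> even (card (R l \<inter> T)) = b)} + C"
      using assms i by (intro prob_row_dependent_le C small_ball) auto
    also have "\<dots> \<le> measure_pmf.prob ?P (II i) + C"
      unfolding II_def t_def by (intro add_right_mono measure_pmf.finite_measure_mono) (auto intro: less_imp_le)
    finally show ?thesis using II[OF i] by linarith
  qed
  have "measure_pmf.prob (random_zero_one_mat n d) {Q. \<not> invertible_mat Q}
      = measure_pmf.prob ?P {R. \<not> invertible_mat (incidence_mat n R)}"
    using assms(2) by (simp add: random_zero_one_mat_incidence vimage_def)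
  also have "\<dots> \<le> measure_pmf.prob ?P (I \<union> {R. t \<le> real (card {i. i < n \<and> dependent_row n R i})})"
  proof (rule measure_pmf.finite_measure_mono)
    show "{R. \<not> invertible_mat (incidence_mat n R)} \<subseteq> I \<union> {R. t \<le> real (card {i. i < n \<and> dependent_row n R i})}"
    proof (intro subsetI, unfold mem_Collect_eq)
      fix R assume "\<not> invertible_mat (incidence_mat n R)"
      from singular_cases[OF this, of t]
      show "R \<in> I \<union> {R. t \<le> real (card {i. i < n \<and> dependent_row n R i})}"
        unfolding I_def t_def using less_imp_le by blast
    qed
  qed simp
  also have "\<dots> \<le> measure_pmf.prob ?P I + measure_pmf.prob ?P {R. t \<le> real (card {i. i < n \<and> dependent_row n R i})}"
    by (rule measure_Un_le) auto
  also have "\<dots> \<le> r + (2 * r + C) / c"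
  proof (rule add_mono[OF I])
    have "measure_pmf.prob ?P {R. t \<le> real (card {i. i < n \<and> dependent_row n R i})}
        \<le> (\<Sum>i<n. measure_pmf.prob ?P {R. dependent_row n R i}) / t"
      by (rule prob_many_events_le[OF t])
    also have "\<dots> \<le> (\<Sum>i<n. 2 * r + C) / t"
      using t dep by (intro divide_right_mono sum_mono) auto
    also have "\<dots> = (2 * r + C) / c" using assms by (simp add: t_def)
    finally show "measure_pmf.prob ?P {R. t \<le> real (card {i. i < n \<and> dependent_row n R i})} \<le> (2 * r + C) / c" .
  qed
  finally show ?thesis .
qed

text \<open>With D the minimum, the variance is D (1 - D / n), which increases in D up to n / 2. The
  difference of two values factors as (D - x) (1 - (D + x) / n).\<close>

lemma row_variance_lower:
  assumes "d \<le> n" "0 < n" "x \<le> real (min d (n - d))"  "x \<le> real n / 2"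
  shows "x * (1 - x / real n) \<le> row_variance n d"
proof -
  define D where "D = real (min d (n - d))"
  have D: "D \<le> real n / 2" "x \<le> D" using assms by (auto simp: D_def min_def)
  have "real d * real (n - d) = D * (real n - D)"
    using assms(1) by (auto simp: D_def min_def algebra_simps)
  then have "row_variance n d = D * (1 - D / real n)"
    using assms(2) by (simp add: row_variance_def field_simps)
  moreover have "0 \<le> (D - x) * (1 - (D + x) / real n)"
    using D assms by (intro mult_nonneg_nonneg) (auto simp: field_simps)
  moreover have "(D - x) * (1 - (D + x) / real n) = D * (1 - D / real n) - x * (1 - x / real n)"
    using assms(2) by (simp add: field_simps)
  ultimately show ?thesis by simp
qed

theorem theorem1p2:
  fixes \<epsilon> :: real and d :: "nat \<Rightarrow> nat"
  assumes "\<epsilon> > 0"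
    and "\<And>n. d n \<le> n"
    and "\<forall>\<^sub>F n in sequentially. real (min (d n) (n - d n)) \<ge> (1 + \<epsilon>) * ln (real n)"
  shows "(\<lambda>n. measure_pmf.prob (random_zero_one_mat n (d n)) {Q. \<not> invertible_mat Q}) \<longlonglongrightarrow> 0"
proof -
  define L where "L n = row_variance n (d n)" for n
  have "\<forall>\<^sub>F n in sequentially. (1 + \<epsilon>) * ln (real n) \<le> real n / 2" using assms(1) by real_asymp
  \<comment> \<open>Passing from the minimum to the variance costs a factor 1 - O(log n / n),
    absorbed by lowering \<epsilon> to \<epsilon> / 2.\<close>
  moreover have "\<forall>\<^sub>F n in sequentially.
      (1 + \<epsilon> / 2) * ln (real n) \<le> (1 + \<epsilon>) * ln (real n) * (1 - (1 + \<epsilon>) * ln (real n) / real n)"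
    using assms(1) by real_asymp
  ultimately have lower: "\<forall>\<^sub>F n in sequentially. (1 + \<epsilon> / 2) * ln (real n) \<le> L n"
    using assms(3) eventually_gt_at_top[of 0]
  proof eventually_elim
    case (elim n)
    then show ?case
      unfolding L_def using row_variance_lower[OF assms(2), of n "(1 + \<epsilon>) * ln (real n)"] by linarith
  qed
  have L_top: "filterlim L at_top sequentially"
  proof (rule filterlim_at_top_mono[OF _ lower])
    show "filterlim (\<lambda>n. (1 + \<epsilon> / 2) * ln (real n)) at_top sequentially" using assms(1) by real_asymp
  qed
  have upper: "\<forall>\<^sub>F n in sequentially. L n \<le> real n"
    using eventually_gt_at_top[of 0]
  proof eventually_elim
    case (elim n)
    have "real (d n) * real (n - d n) \<le> real n * real n" using assms(2) by (intro mult_mono) auto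
    then show ?case unfolding L_def row_variance_def using elim by (simp add: field_simps)
  qed
  have \<epsilon>2: "0 < \<epsilon> / 2" using assms(1) by simp
  obtain c r where c: "0 < c" "c \<le> 1 / 2" and r: "r \<longlonglongrightarrow> 0"
    and bound: "\<forall>\<^sub>F n in sequentially. \<forall>W.
      (\<forall>S k. S \<subseteq> {..<n} \<longrightarrow> 1 \<le> k \<longrightarrow> k \<le> card S \<longrightarrow> real (card S) \<le> c * real n \<longrightarrow> W S \<le> decay (L n) n k) \<longrightarrow>
      (\<Sum>S | S \<subseteq> {..<n} \<and> S \<noteq> {} \<and> real (card S) \<le> c * real n. W S) \<le> (r n :: real)"
    by (rule sum_decay_tendsto_0[OF \<epsilon>2 lower upper])
  \<comment> \<open>The terms of the bound in \<open>prob_singular_le\<close> that depend on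
    \<open>n\<close> only through \<open>L\<close>, so that their limit follows from
    \<open>L\<close> tending to infinity.\<close>
  define h where "h x = 4 / (c * x) + 1 / sqrt x + 2 * (sqrt x + 1) / (c * x)" for x
  define C where "C n = h (L n) + 32 / real n" for n
  have "(h \<longlongrightarrow> 0) at_top" unfolding h_def using c(1) by real_asymp
  then have "(\<lambda>n. h (L n)) \<longlonglongrightarrow> 0" by (rule filterlim_compose[OF _ L_top])
  moreover have "(\<lambda>n. 32 / real n) \<longlonglongrightarrow> 0" by real_asymp
  ultimately have C: "C \<longlonglongrightarrow> 0" unfolding C_def[abs_def] using tendsto_add[of _ 0 _ _ 0] by fastforce
  show ?thesis
  proof (rule tendsto_sandwich[of "\<lambda>_. 0" _ _ "\<lambda>n. r n + (2 * r n + C n) / c"])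
    have "(\<lambda>n. r n + (2 * r n + C n) / c) \<longlonglongrightarrow> 0 + (2 * 0 + 0) / c"
      using c(1) by (intro tendsto_intros r C) auto
    then show "(\<lambda>n. r n + (2 * r n + C n) / c) \<longlonglongrightarrow> 0" by simp
    have "\<forall>\<^sub>F n in sequentially. 1 < (1 + \<epsilon>) * ln (real n)" using assms(1) by real_asymp
    moreover have "\<forall>\<^sub>F n in sequentially. 1 \<le> L n" using L_top by (simp add: filterlim_at_top)
    ultimately show "\<forall>\<^sub>F n in sequentially.
        measure_pmf.prob (random_zero_one_mat n (d n)) {Q. \<not> invertible_mat Q} \<le> r n + (2 * r n + C n) / c"
      using assms(3) bound eventually_ge_at_top[of 8]
    proof eventually_elim
      case (elim n)
      have "2 \<le> min (d n) (n - d n)" using elim(1,3) by linarith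
      then have "2 \<le> d n" "d n + 2 \<le> n" by auto
      then show ?case
        using prob_singular_le[of "d n" n c "r n"] elim(2,4,5) c
        by (simp add: C_def h_def L_def add_ac)
    qed
  qed simp_all
qed

end
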